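(* Let $n\ge1$ and $1\le p<q<\infty$. If $f\in L^1_{\mathrm{loc}}(\mathbb{R}^n)$ and $f\ge0$ a.e., then $\|f\|_{SR_{p,q}(\mathbb{R}^n)}\approx\|f\|_{H_q^{-n(\frac1p-\frac1q)}(\mathbb{R}^n)}$, with constants independent of $f$. In general, $SR_{p,q}(\mathbb{R}^n)\hookrightarrow H_q^{-n(\frac1p-\frac1q)}(\mathbb{R}^n)$. In particular, for $n\ge2$, $p=\frac{2n}{n+2}$ and $q=2$: $\|f\|_{SR_{\frac{2n}{n+2},2}(\mathbb{R}^n)}\approx\|f\|_{H^{-1}(\mathbb{R}^n)}$ if $f\ge0$, and consequently $SR_{\frac{2n}{n+2},2}(\mathbb{R}^n)\hookrightarrow H^{-1}(\mathbb{R}^n)$.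
   Context: $\mathcal{D}(\mathbb{R}^n)=\{2^{-k}(m+[0,1)^n):k\in\mathbb{Z},m\in\mathbb{Z}^n\}$. A countable family $(Q_i)_{i\in I}\subset\mathcal{D}(\mathbb{R}^n)$ is sparse if there exist pairwise disjoint measurable sets $E_{Q_i}\subseteq Q_i$ with $|E_{Q_i}|\ge\frac12|Q_i|$; $S(\mathbb{R}^n)$ is the collection of all sparse families. With $p'$ the dual exponent ($\frac1p+\frac1{p'}=1$), $SR_{p,q}(\mathbb{R}^n)$ is the set of $f\in L^1_{\mathrm{loc}}(\mathbb{R}^n)$ with $\|f\|_{SR_{p,q}(\mathbb{R}^n)}=\sup_{(Q_i)\in S(\mathbb{R}^n)}\big\{\sum_{i}\big(|Q_i|^{-1/p'}\int_{Q_i}|f|\big)^q\big\}^{1/q}<\infty$. For $0<\lambda<n$, $I_\lambda f(x)=\int_{\mathbb{R}^n}f(y)|x-y|^{\lambda-n}dy$ and $H_q^{-\lambda}(\mathbb{R}^n)=\{f\in L^1_{\mathrm{loc}}:\|f\|_{H_q^{-\lambda}}=\|I_\lambda f\|_{L^q(\mathbb{R}^n)}<\infty\}$; $H^{-1}=H_2^{-1}$. *)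

theory Defs
  imports "HOL-Analysis.Analysis"
begin

text \<open>Real powers of extended nonnegative reals (exponent assumed positive):
  infinity stays infinity, finite values use the real power.\<close>
definition epowr :: "ennreal \<Rightarrow> real \<Rightarrow> ennreal" where
  "epowr x r = (if x = \<infinity> then \<infinity> else ennreal (enn2real x powr r))"

definition dyadic_cubes :: "(real^'n) set set" where
  "dyadic_cubes = {Q. \<exists>(k::int) (m::'n \<Rightarrow> int).
      Q = {x. \<forall>i. 2 powr (- real_of_int k) * real_of_int (m i) \<le> x $ i \<and>
                   x $ i < 2 powr (- real_of_int k) * (real_of_int (m i) + 1)}}"

definition sparse_family :: "nat set \<Rightarrow> (nat \<Rightarrow> (real^'n) set) \<Rightarrow> bool" where
  "sparse_family I Q \<longleftrightarrow> (\<forall>i\<in>I. Q i \<in> dyadic_cubes) \<and>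
     (\<exists>E. (\<forall>i\<in>I. E i \<in> sets lebesgue \<and> E i \<subseteq> Q i \<and>
              measure lebesgue (E i) \<ge> measure lebesgue (Q i) / 2)
          \<and> disjoint_family_on E I)"

definition locally_integrable :: "(real^'n \<Rightarrow> real) \<Rightarrow> bool" where
  "locally_integrable f \<longleftrightarrow> f \<in> borel_measurable lebesgue \<and>
     (\<forall>K. compact K \<longrightarrow> set_integrable lebesgue K f)"

text \<open>The SR_{p,q} (quasi)norm; 1/p' = 1 - 1/p.\<close>
definition SR_norm :: "real \<Rightarrow> real \<Rightarrow> (real^'n \<Rightarrow> real) \<Rightarrow> ennreal" where
  "SR_norm p q f = epowr
     (SUP IQ \<in> {(I, Q). sparse_family I Q}.
        infsum (\<lambda>i. epowr (ennreal (measure lebesgue (snd IQ i) powr (- (1 - 1 / p)))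
                         * (\<integral>\<^sup>+ x \<in> snd IQ i. ennreal \<bar>f x\<bar> \<partial>lebesgue)) q) (fst IQ))
     (1 / q)"

definition riesz_potential :: "real \<Rightarrow> (real^'n \<Rightarrow> real) \<Rightarrow> real^'n \<Rightarrow> real" where
  "riesz_potential lam f x =
     (\<integral> y. f y * norm (x - y) powr (lam - real CARD('n)) \<partial>lebesgue)"

text \<open>Pointwise |I_lambda f x| as an extended nonnegative real: the absolute value of the
  Lebesgue integral when the integral converges absolutely, and infinity otherwise
  (for f \<ge> 0 this is exactly the value of the nonnegative integral).\<close>
definition riesz_abs :: "real \<Rightarrow> (real^'n \<Rightarrow> real) \<Rightarrow> real^'n \<Rightarrow> ennreal" where
  "riesz_abs lam f x =
     (if integrable lebesgue (\<lambda>y. f y * norm (x - y) powr (lam - real CARD('n)))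
      then ennreal \<bar>riesz_potential lam f x\<bar> else \<infinity>)"

text \<open>The norm of H_q^{-lambda}: the L^q norm of I_lambda f.\<close>
definition H_norm :: "real \<Rightarrow> real \<Rightarrow> (real^'n \<Rightarrow> real) \<Rightarrow> ennreal" where
  "H_norm q lam f = epowr (\<integral>\<^sup>+ x. epowr (riesz_abs lam f x) q \<partial>lebesgue) (1 / q)"

end

theory Submission
  imports Defs
begin

text \<open>Since \<open>1/p' = 1 - 1/p\<close> and \<open>\<lambda> = n (1/p - 1/q)\<close>, the term of a cube \<open>Q\<close> in the sparse norm is
  \<open>|Q| (|Q| powr (\<lambda>/n - 1) \<integral>\<^sub>Q |f|) powr q\<close>, and the inner factor is at most a constant times
  \<open>I\<^sub>\<lambda> f\<close> at each point of \<open>Q\<close> when \<open>f \<ge> 0\<close>. Integrating over the disjoint sets \<open>E\<^sub>Q\<close> bounds the sparse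
  norm by the Riesz potential norm.

  Conversely, \<open>I\<^sub>\<lambda> |f|\<close> is dominated by a sum over the scales \<open>k\<close> of functions \<open>X\<^sub>k\<close> that are constant on
  the dyadic cubes of side \<open>2 powr (-k)\<close>, and the mean of \<open>X\<^sub>k\<close> over a cube of scale \<open>j \<le> k\<close> is at most
  \<open>C 2 powr (-(k - j) \<lambda>) X\<^sub>j\<close>. The Garsia--Neveu inequality then gives Wolff's inequality: the \<open>L\<^sup>q\<close> norm
  of the sum is controlled by the \<open>q\<close>-sum of the terms of all dyadic cubes. Finally this sum over all
  cubes is controlled by the sum over the (sparse) Calderon--Zygmund stopping cubes, because \<open>q > p\<close>
  makes the cubes with a given stopping ancestor contribute a geometric series.\<close>

section \<open>Dyadic cubes\<close>

text \<open>Two points much closer than the side length of a cube can still be separated by its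
  boundary, so the cubes containing a point do not see all the mass near it. Each
  \<open>X\<^sub>k\<close> therefore collects the mass of a cube and of the adjacent cubes of equal
  size. Adjacency survives passage to ancestors, so the decay estimate reproduces a quantity of the
  same kind. Its rate comes from the kernel size \<open>2 powr (k (n - \<lambda>))\<close> times the
  cube volume \<open>2 powr (-k n)\<close>, which leaves \<open>2 powr (-k \<lambda>)\<close>,
  summable over finer scales because \<lambda> > 0.

  There is no coarsest scale. Finite windows of scales are treated with constants independent of the
  window, and maximal stopping cubes exist only if averages tend to 0 along ancestors. A single cube
  is a sparse family, so a finite sparse norm bounds every term and forces this decay; for an
  infinite sparse norm the upper bound is trivial.

  The upper bound sees only |f|. The sign of f matters in the converse, where cancellation could
  make \<open>I\<^sub>\<lambda> f\<close> much smaller than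
  \<open>I\<^sub>\<lambda> |f|\<close>.\<close>

definition idx :: "int \<Rightarrow> real^'n \<Rightarrow> 'n \<Rightarrow> int" where
  "idx k x = (\<lambda>i. \<lfloor>2 powr real_of_int k * x $ i\<rfloor>)"

text \<open>Defined as fibres of \<open>idx\<close>, the cubes of one scale partition space by
  construction, and the functions constant on them are exactly those of the form
  \<open>h (idx k x)\<close>.\<close>

definition cube :: "int \<Rightarrow> ('n \<Rightarrow> int) \<Rightarrow> (real^'n) set" where
  "cube k m = {x. idx k x = m}"

lemma mem_cube: "x \<in> cube k m \<longleftrightarrow> idx k x = m"
  by (simp add: cube_def)

lemma cube_eq:
  "cube k m = {x. \<forall>i. 2 powr (- real_of_int k) * real_of_int (m i) \<le> x $ i \<and>
                   x $ i < 2 powr (- real_of_int k) * (real_of_int (m i) + 1)}"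
proof -
  have "\<lfloor>2 powr real_of_int k * t\<rfloor> = j \<longleftrightarrow>
      2 powr (- real_of_int k) * real_of_int j \<le> t \<and> t < 2 powr (- real_of_int k) * (real_of_int j + 1)"
    for t j
    by (simp add: floor_eq_iff powr_minus field_simps)
  then show ?thesis
    by (simp add: cube_def idx_def fun_eq_iff)
qed

lemma dyadic_cubes_eq: "dyadic_cubes = {cube k m |k m. True}"
  unfolding dyadic_cubes_def cube_eq by blast

text \<open>Nestedness of the dyadic grid: taking the floor commutes with division by a positive
  integer, and \<open>div\<close> rounds down for negative indices too.\<close>

lemma idx_coarse: "idx (k - int l) x i = idx k x i div 2 ^ l"
proof -
  have "2 powr real_of_int (k - int l) * x $ i
      = (2 powr real_of_int k * x $ i) / real_of_int (2 ^ l)"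
    by (simp add: powr_diff powr_realpow)
  then show ?thesis
    unfolding idx_def by (metis floor_divide_real_eq_div zero_le_numeral zero_le_power)
qed

text \<open>The open and the closed box with the same corners have equal measure, which forces the
  measure of the half-open cube between them.\<close>

lemma cube_sandwich:
  fixes k :: int and m :: "'n::finite \<Rightarrow> int"
  defines "a \<equiv> (\<chi> i. 2 powr (- real_of_int k) * real_of_int (m i))"
    and "b \<equiv> (\<chi> i. 2 powr (- real_of_int k) * (real_of_int (m i) + 1))"
  shows "box a b \<subseteq> cube k m" "cube k m \<subseteq> cbox a b"
    "cube k m \<in> sets borel"
    "measure lborel (box a b) = 2 powr (- real_of_int k * real CARD('n))"
    "measure lborel (cbox a b) = 2 powr (- real_of_int k * real CARD('n))"
proof -
  show "box a b \<subseteq> cube k m" "cube k m \<subseteq> cbox a b"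
    by (auto simp: cube_eq a_def b_def mem_box_cart less_imp_le)
  show "cube k m \<in> sets borel"
    unfolding cube_eq by measurable
  have "cbox a b \<noteq> {}"
    by (auto simp: interval_ne_empty_cart a_def b_def)
  then have "measure lborel (cbox a b) = (\<Prod>i\<in>UNIV. b $ i - a $ i)"
    by (rule content_cbox_cart)
  also have "\<dots> = (2 powr (- real_of_int k)) ^ CARD('n)"
    by (simp add: a_def b_def algebra_simps)
  also have "\<dots> = 2 powr (- real_of_int k * real CARD('n))"
    by (simp add: powr_powr flip: powr_realpow)
  finally show c: "measure lborel (cbox a b) = 2 powr (- real_of_int k * real CARD('n))" .
  then show "measure lborel (box a b) = 2 powr (- real_of_int k * real CARD('n))"
    by (simp add: measure_def emeasure_lborel_box_eq emeasure_lborel_cbox_eq)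
qed

lemma cube_sets [measurable]: "cube k m \<in> sets borel" "cube k m \<in> sets lebesgue"
  using cube_sandwich(3)[of k m] by (auto simp: sets_completionI_sets)

lemma emeasure_cube:
  fixes m :: "'n::finite \<Rightarrow> int"
  shows "emeasure lebesgue (cube k m) = ennreal (2 powr (- real_of_int k * real CARD('n)))"
proof -
  define a b where "a = (\<chi> i. 2 powr (- real_of_int k) * real_of_int (m i))"
    and "b = (\<chi> i. 2 powr (- real_of_int k) * (real_of_int (m i) + 1))"
  note s = cube_sandwich[where k=k and m=m, folded a_def b_def]
  have e: "emeasure lborel (box a b) = ennreal (2 powr (- real_of_int k * real CARD('n)))"
    "emeasure lborel (cbox a b) = ennreal (2 powr (- real_of_int k * real CARD('n)))"
    by (subst emeasure_eq_ennreal_measure; use s(4,5) emeasure_lborel_box_finite[of a b]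
        emeasure_lborel_cbox_finite[of a b] in \<open>simp add: less_top\<close>)+
  have "emeasure lborel (box a b) \<le> emeasure lborel (cube k m)"
    "emeasure lborel (cube k m) \<le> emeasure lborel (cbox a b)"
    using s(1,2,3) by (auto intro!: emeasure_mono)
  then have "emeasure lborel (cube k m) = ennreal (2 powr (- real_of_int k * real CARD('n)))"
    using e by simp
  then show ?thesis
    using s(3) by simp
qed

lemma measure_cube:
  fixes m :: "'n::finite \<Rightarrow> int"
  shows "measure lebesgue (cube k m) = 2 powr (- real_of_int k * real CARD('n))"
  by (simp add: measure_def emeasure_cube)

lemma idx_measurable [measurable]: "idx k \<in> measurable lebesgue (count_space UNIV)"
proof (subst measurable_count_space_eq2_countable, intro conjI ballI)
  show "idx k -` {a} \<inter> space lebesgue \<in> sets lebesgue" for a :: "'a \<Rightarrow> int"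
    using cube_sets(2)[of k a] by (simp add: cube_def vimage_def)
qed auto

text \<open>Every point lies in exactly one cube of scale \<open>k\<close>, so the left integrand is
  a sum over \<open>m\<close> with a single nonzero term, and Tonelli applies. Later changes of
  scale pass back and forth between integrals and lattice sums in this way.\<close>

lemma nn_integral_idx:
  fixes g :: "real^'n \<Rightarrow> ennreal" and h :: "('n \<Rightarrow> int) \<Rightarrow> ennreal"
  assumes [measurable]: "g \<in> borel_measurable lebesgue"
  shows "(\<integral>\<^sup>+x. h (idx k x) * g x \<partial>lebesgue)
    = (\<integral>\<^sup>+m. h m * (\<integral>\<^sup>+x\<in>cube k m. g x \<partial>lebesgue) \<partial>count_space UNIV)"
proof -
  have "(\<integral>\<^sup>+m. h m * (g x * indicator (cube k m) x) \<partial>count_space UNIV) = h (idx k x) * g x" for x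
  proof -
    have "(\<integral>\<^sup>+m. h m * (g x * indicator (cube k m) x) \<partial>count_space UNIV)
        = (\<integral>\<^sup>+m. h m * g x * indicator {idx k x} m \<partial>count_space UNIV)"
      by (intro nn_integral_cong) (auto simp: indicator_def mem_cube)
    then show ?thesis
      by (simp add: nn_integral_count_space_indicator[symmetric] nn_integral_count_space_finite)
  qed
  then have "(\<integral>\<^sup>+x. h (idx k x) * g x \<partial>lebesgue)
      = (\<integral>\<^sup>+x. (\<integral>\<^sup>+m. h m * (g x * indicator (cube k m) x) \<partial>count_space UNIV) \<partial>lebesgue)"
    by simp
  also have "\<dots> = (\<integral>\<^sup>+m. (\<integral>\<^sup>+x. h m * (g x * indicator (cube k m) x) \<partial>lebesgue) \<partial>count_space UNIV)"
    by (rule nn_integral_count_space_nn_integral) auto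
  also have "\<dots> = (\<integral>\<^sup>+m. h m * (\<integral>\<^sup>+x\<in>cube k m. g x \<partial>lebesgue) \<partial>count_space UNIV)"
    by (intro nn_integral_cong nn_integral_cmult) auto
  finally show ?thesis .
qed

lemma nn_integral_idx_1:
  fixes h :: "('n::finite \<Rightarrow> int) \<Rightarrow> ennreal"
  shows "(\<integral>\<^sup>+x. h (idx k x) \<partial>lebesgue)
    = ennreal (2 powr (- real_of_int k * real CARD('n))) * (\<integral>\<^sup>+m. h m \<partial>count_space UNIV)"
  using nn_integral_idx[of "\<lambda>_. 1" h k]
  by (simp add: emeasure_cube nn_integral_multc mult.commute)

section \<open>Powers of extended reals and the Garsia--Neveu inequality\<close>

lemma epowr_ennreal [simp]: "0 \<le> x \<Longrightarrow> epowr (ennreal x) r = ennreal (x powr r)"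
  by (simp add: epowr_def)

lemma epowr_top [simp]: "epowr top r = top"
  by (simp add: epowr_def)

lemma epowr_0 [simp]: "epowr 0 r = 0"
  by (simp add: epowr_def)

lemma epowr_1 [simp]: "epowr x 1 = x"
  by (cases x) auto

lemma epowr_mono: "x \<le> y \<Longrightarrow> 0 \<le> r \<Longrightarrow> epowr x r \<le> epowr y r"
  by (cases x; cases y) (auto simp: top_unique intro!: ennreal_leI powr_mono2)

lemma epowr_epowr: "epowr (epowr x r) s = epowr x (r * s)"
  by (cases x) (auto simp: powr_powr)

lemma epowr_mult: "epowr (x * y) r = epowr x r * epowr y r"
proof (cases x)
  case x: (real a)
  show ?thesis
  proof (cases y)
    case (real b)
    with x show ?thesis by (simp add: powr_mult flip: ennreal_mult)
  next
    case top
    with x show ?thesis by (cases "a = 0") (auto simp: ennreal_mult_top)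
  qed
next
  case x: top
  show ?thesis
  proof (cases y)
    case (real b)
    with x show ?thesis by (cases "b = 0") (auto simp: ennreal_top_mult)
  qed (use x in auto)
qed

text \<open>The power \<open>1 / r\<close> undoes the power \<open>r\<close>, so the claim moves
  inside the supremum and becomes monotonicity.\<close>

lemma epowr_SUP_le:
  assumes "0 < r"
  shows "epowr (SUP i\<in>I. f i) r \<le> (SUP i\<in>I. epowr (f i) r)"
proof -
  have "f i \<le> epowr (SUP i\<in>I. epowr (f i) r) (1 / r)" if "i \<in> I" for i
  proof -
    have "f i = epowr (epowr (f i) r) (1 / r)"
      using assms by (simp add: epowr_epowr)
    also have "\<dots> \<le> epowr (SUP i\<in>I. epowr (f i) r) (1 / r)"
      using assms that by (intro epowr_mono SUP_upper) auto
    finally show ?thesis .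
  qed
  then have "epowr (SUP i\<in>I. f i) r \<le> epowr (epowr (SUP i\<in>I. epowr (f i) r) (1 / r)) r"
    using assms by (intro epowr_mono SUP_least) auto
  then show ?thesis
    using assms by (simp add: epowr_epowr)
qed

lemma epowr_measurable [measurable]:
  "f \<in> borel_measurable M \<Longrightarrow> (\<lambda>x. epowr (f x) r) \<in> borel_measurable M"
proof -
  assume [measurable]: "f \<in> borel_measurable M"
  have [measurable]: "{x \<in> space M. f x = \<infinity>} \<in> sets M"
    using measurable_sets[of f M borel "{\<infinity>}"] by (simp add: vimage_def Int_def conj_commute)
  show ?thesis
    unfolding epowr_def by measurable
qed

text \<open>By the mean value theorem the slope \<open>q * z powr (q - 1)\<close> is at most the
  slope at \<open>b\<close>. The case \<open>a = 0\<close> is split off because the derivative of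
  \<open>powr\<close> is taken at positive bases; there \<open>1 \<le> q\<close> suffices.\<close>

lemma powr_diff_le:
  fixes a b q :: real
  assumes "0 \<le> a" "a \<le> b" "1 \<le> q"
  shows "b powr q - a powr q \<le> q * (b - a) * b powr (q - 1)"
proof (cases "a = 0 \<or> a = b")
  case True
  have "b powr q = b * b powr (q - 1)"
    using assms by (cases "b = 0") (auto simp: powr_diff)
  moreover have "b * b powr (q - 1) \<le> q * (b * b powr (q - 1))"
    using assms mult_right_mono[of 1 q "b * b powr (q - 1)"] by simp
  ultimately show ?thesis
    using True by (auto simp: mult.assoc)
next
  case False
  with assms have "0 < a" "a < b" by auto
  have "\<exists>z. a < z \<and> z < b \<and> b powr q - a powr q = (b - a) * (q * z powr (q - 1))"
    using \<open>0 < a\<close> \<open>a < b\<close>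
    by (intro MVT2) (auto intro!: derivative_eq_intros simp: powr_diff)
  then obtain z where "a < z" "z < b" "b powr q - a powr q = (b - a) * (q * z powr (q - 1))"
    by blast
  moreover have "z powr (q - 1) \<le> b powr (q - 1)"
    using \<open>0 < a\<close> \<open>a < z\<close> \<open>z < b\<close> assms by (intro powr_mono2) auto
  ultimately show ?thesis
    using \<open>a < b\<close> assms by (simp add: mult.assoc mult.left_commute mult_left_mono)
qed

section \<open>Summation by parts and absorption for a single nonnegative sequence\<close>

context
  fixes s :: "nat \<Rightarrow> real" and q :: real
  assumes nonneg: "\<And>i. 0 \<le> s i" and q: "1 < q"
begin

lemma partial_sum_powr_telescope:
  "(\<Sum>j<n. (\<Sum>i<Suc j. s i) powr (q - 1) - (\<Sum>i<j. s i) powr (q - 1)) = (\<Sum>i<n. s i) powr (q - 1)"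
  by (subst sum_lessThan_telescope) simp

text \<open>Discrete form of d(T^q) \<le> q T^(q-1) dT, with T^(q-1) expanded into its increments
  and the order of summation exchanged. The increment at \<open>j\<close> depends on the past up to
  \<open>j\<close> only and multiplies the tail from \<open>j\<close> on, so that averages of the
  tail can be used.\<close>

lemma sum_powr_le_increments:
  "(\<Sum>i<n. s i) powr q
    \<le> q * (\<Sum>j<n. ((\<Sum>i<Suc j. s i) powr (q - 1) - (\<Sum>i<j. s i) powr (q - 1)) * (\<Sum>i=j..<n. s i))"
proof (induction n)
  case 0
  then show ?case by simp
next
  case (Suc n)
  let ?T = "\<lambda>j. \<Sum>i<j. s i" and ?H = "\<lambda>j. (\<Sum>i<Suc j. s i) powr (q - 1) - (\<Sum>i<j. s i) powr (q - 1)"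
  \<comment> \<open>Every tail, including the formerly empty one at \<open>j = n\<close>, grows by
    \<open>s n\<close>; the increments multiplying it telescope.\<close>
  have "(\<Sum>j<Suc n. ?H j * (\<Sum>i=j..<Suc n. s i)) = (\<Sum>j<Suc n. ?H j * (\<Sum>i=j..<n. s i) + s n * ?H j)"
    by (intro sum.cong) (auto simp: algebra_simps)
  also have "\<dots> = (\<Sum>j<n. ?H j * (\<Sum>i=j..<n. s i)) + s n * (\<Sum>j<Suc n. ?H j)"
    by (simp add: sum.distrib sum_distrib_left del: sum.lessThan_Suc) simp
  also have "\<dots> = (\<Sum>j<n. ?H j * (\<Sum>i=j..<n. s i)) + s n * ?T (Suc n) powr (q - 1)"
    by (simp only: partial_sum_powr_telescope)
  finally have eq: "(\<Sum>j<Suc n. ?H j * (\<Sum>i=j..<Suc n. s i))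
      = (\<Sum>j<n. ?H j * (\<Sum>i=j..<n. s i)) + s n * ?T (Suc n) powr (q - 1)" .
  have "?T (Suc n) powr q - ?T n powr q \<le> q * (?T (Suc n) - ?T n) * ?T (Suc n) powr (q - 1)"
    using q by (intro powr_diff_le) (auto intro: sum_nonneg nonneg)
  then have "?T (Suc n) powr q \<le> ?T n powr q + q * (s n * ?T (Suc n) powr (q - 1))"
    by simp
  also have "\<dots> \<le> q * (\<Sum>j<n. ?H j * (\<Sum>i=j..<n. s i)) + q * (s n * ?T (Suc n) powr (q - 1))"
    using Suc.IH by simp
  also have "\<dots> = q * (\<Sum>j<Suc n. ?H j * (\<Sum>i=j..<Suc n. s i))"
    unfolding eq by (simp add: distrib_left)
  finally show ?case .
qed

lemma partial_sum_powr_increment_nonneg: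
  "0 \<le> (\<Sum>i<Suc j. s i) powr (q - 1) - (\<Sum>i<j. s i) powr (q - 1)"
  using q nonneg by (auto intro!: powr_mono2 sum_nonneg)

text \<open>Replacing each \<open>s j\<close> by the maximum \<open>x\<close> telescopes the left
  side to c t^(q-1) x, where t is the total. If 2cx \<le> t, this is at most half of t^q; otherwise
  it is at most half of (2cx)^q, and x^q is one of the summands on the right. The factor 1/2 leaves
  room for absorption.\<close>

lemma increments_young:
  fixes c :: real
  assumes c: "0 < c"
  shows "c * (\<Sum>j<n. ((\<Sum>i<Suc j. s i) powr (q - 1) - (\<Sum>i<j. s i) powr (q - 1)) * s j)
    \<le> (\<Sum>i<n. s i) powr q / 2 + (2 * c) powr q / 2 * (\<Sum>j<n. s j powr q)"
proof (cases "n = 0")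
  case False
  let ?H = "\<lambda>j. (\<Sum>i<Suc j. s i) powr (q - 1) - (\<Sum>i<j. s i) powr (q - 1)"
  define x where "x = Max (s ` {..<n})"
  define t where "t = (\<Sum>i<n. s i)"
  have "x \<in> s ` {..<n}"
    unfolding x_def using False by (intro Max_in) auto
  then obtain j0 where j0: "j0 < n" "x = s j0" by auto
  have x: "s j \<le> x" if "j < n" for j
    unfolding x_def using that by simp
  have t0: "0 \<le> t" "0 \<le> x"
    by (auto simp: t_def j0 intro: sum_nonneg nonneg)
  have "(\<Sum>j<n. ?H j * s j) \<le> (\<Sum>j<n. ?H j * x)"
    using x partial_sum_powr_increment_nonneg by (intro sum_mono mult_left_mono) auto
  also have "\<dots> = t powr (q - 1) * x"
    unfolding t_def by (simp only: partial_sum_powr_telescope flip: sum_distrib_right)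
  finally have 1: "c * (\<Sum>j<n. ?H j * s j) \<le> c * (t powr (q - 1) * x)"
    using c by simp
  have 2: "c * (t powr (q - 1) * x) \<le> t powr q / 2 + (2 * c) powr q / 2 * x powr q"
  proof (cases "2 * c * x \<le> t")
    case True
    then have "t powr (q - 1) * (2 * c * x) \<le> t powr (q - 1) * t"
      by (intro mult_left_mono) auto
    also have "\<dots> = t powr q"
      using t0 by (cases "t = 0") (auto simp: powr_diff)
    finally have "c * (t powr (q - 1) * x) \<le> t powr q / 2" by (simp add: algebra_simps)
    then show ?thesis
      by (meson add_increasing2 divide_nonneg_nonneg mult_nonneg_nonneg powr_ge_zero zero_le_numeral)
  next
    case False
    then have "t powr (q - 1) * (2 * c * x) \<le> (2 * c * x) powr (q - 1) * (2 * c * x)"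
      using t0 c q by (intro mult_right_mono powr_mono2) auto
    also have "\<dots> = (2 * c * x) powr q"
      using t0 c by (cases "x = 0") (auto simp: powr_diff)
    also have "\<dots> = (2 * c) powr q * x powr q"
      using t0 c by (simp add: powr_mult)
    finally have "2 * (c * (t powr (q - 1) * x)) \<le> (2 * c) powr q * x powr q"
      by (simp add: mult_ac)
    then show ?thesis
      using powr_ge_zero[of t q] by linarith
  qed
  have "x powr q \<le> (\<Sum>j<n. s j powr q)"
    unfolding j0(2) using j0(1) by (intro member_le_sum) auto
  then have "(2 * c) powr q / 2 * x powr q \<le> (2 * c) powr q / 2 * (\<Sum>j<n. s j powr q)"
    by (intro mult_left_mono) auto
  with 1 2 show ?thesis
    unfolding t_def by linarith
qed simp

end

text \<open>Bounding each summand by the maximum gives this crude constant. It is harmless for the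
  fixed number of neighbours of a cube; for partial sums over scales it serves only to establish
  finiteness.\<close>

lemma sum_powr_le_powr_sum:
  fixes s :: "'a \<Rightarrow> real"
  assumes fin: "finite A" and nonneg: "\<And>i. i \<in> A \<Longrightarrow> 0 \<le> s i" and q: "0 \<le> q"
  shows "(\<Sum>i\<in>A. s i) powr q \<le> real (card A) powr q * (\<Sum>j\<in>A. s j powr q)"
proof (cases "A = {}")
  case False
  define x where "x = Max (s ` A)"
  have "x \<in> s ` A"
    unfolding x_def using False fin by (intro Max_in) auto
  then obtain j0 where j0: "j0 \<in> A" "x = s j0" by auto
  have x: "s j \<le> x" if "j \<in> A" for j
    unfolding x_def using that fin by simp
  have "(\<Sum>i\<in>A. s i) powr q \<le> (real (card A) * x) powr q"
    using q x sum_bounded_above[of A s x] by (intro powr_mono2) (auto intro: sum_nonneg nonneg)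
  also have "\<dots> = real (card A) powr q * x powr q"
    using nonneg j0 by (simp add: powr_mult)
  also have "\<dots> \<le> real (card A) powr q * (\<Sum>j\<in>A. s j powr q)"
    unfolding j0(2) using j0(1) fin by (intro mult_left_mono member_le_sum) auto
  finally show ?thesis .
qed simp

text \<open>The Garsia--Neveu inequality for increasing processes: summation by parts against the
  increments of the power of the partial sums, then absorption of half of the left-hand side.\<close>
lemma nn_integral_sum_powr_le:
  fixes X :: "nat \<Rightarrow> 'a \<Rightarrow> real" and C q :: real
  defines "H \<equiv> \<lambda>j x. (\<Sum>i<Suc j. X i x) powr (q - 1) - (\<Sum>i<j. X i x) powr (q - 1)"
  assumes [measurable]: "\<And>i. X i \<in> borel_measurable M"
    and nonneg: "\<And>i x. 0 \<le> X i x" and q: "1 < q" and C: "0 < C"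
    and future: "\<And>j. j < n \<Longrightarrow>
      (\<integral>\<^sup>+x. ennreal (H j x * (\<Sum>i=j..<n. X i x)) \<partial>M) \<le> ennreal C * (\<integral>\<^sup>+x. ennreal (H j x * X j x) \<partial>M)"
  shows "(\<integral>\<^sup>+x. ennreal ((\<Sum>i<n. X i x) powr q) \<partial>M)
    \<le> ennreal ((2 * (q * C)) powr q) * (\<Sum>j<n. \<integral>\<^sup>+x. ennreal (X j x powr q) \<partial>M)"
proof -
  have [measurable]: "H j \<in> borel_measurable M" for j
    unfolding H_def by measurable
  have H0: "0 \<le> H j x" for j x
    unfolding H_def using nonneg q by (intro partial_sum_powr_increment_nonneg) auto
  define A where "A = (\<integral>\<^sup>+x. ennreal ((\<Sum>i<n. X i x) powr q) \<partial>M)"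
  define B where "B = (\<Sum>j<n. \<integral>\<^sup>+x. ennreal (X j x powr q) \<partial>M)"
  define K where "K = (2 * (q * C)) powr q"
  have K: "0 < K"
    using q C by (simp add: K_def)
  have halves: "ennreal (a / 2 + K / 2 * b) = ennreal (1 / 2) * ennreal a + ennreal (K / 2) * ennreal b"
    if "0 \<le> a" "0 \<le> b" for a b
  proof -
    have "ennreal (a / 2) = ennreal (1 / 2) * ennreal a"
      using that by (subst ennreal_mult[symmetric]) auto
    moreover have "ennreal (K / 2 * b) = ennreal (K / 2) * ennreal b"
      using that K by (intro ennreal_mult) auto
    moreover have "ennreal (a / 2 + K / 2 * b) = ennreal (a / 2) + ennreal (K / 2 * b)"
      using that K by (intro ennreal_plus) auto
    ultimately show ?thesis by (simp only:)
  qed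
  have B_eq: "B = (\<integral>\<^sup>+x. ennreal (\<Sum>j<n. X j x powr q) \<partial>M)"
    unfolding B_def by (subst nn_integral_sum[symmetric]) (auto simp: sum_ennreal)
  have "A \<le> (\<integral>\<^sup>+x. ennreal (q * (\<Sum>j<n. H j x * (\<Sum>i=j..<n. X i x))) \<partial>M)"
    unfolding A_def H_def using nonneg q
    by (intro nn_integral_mono ennreal_leI sum_powr_le_increments) auto
  also have "\<dots> = ennreal q * (\<Sum>j<n. \<integral>\<^sup>+x. ennreal (H j x * (\<Sum>i=j..<n. X i x)) \<partial>M)"
    using q H0 nonneg
    by (subst nn_integral_sum[symmetric])
      (auto simp: ennreal_mult sum_nonneg simp flip: nn_integral_cmult sum_ennreal)
  also have "\<dots> \<le> ennreal q * (\<Sum>j<n. ennreal C * (\<integral>\<^sup>+x. ennreal (H j x * X j x) \<partial>M))"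
    by (intro mult_left_mono sum_mono future) auto
  also have "\<dots> = ennreal (q * C) * (\<integral>\<^sup>+x. ennreal (\<Sum>j<n. H j x * X j x) \<partial>M)"
    using q C H0 nonneg
    by (subst sum_ennreal[symmetric])
      (auto simp: nn_integral_sum ennreal_mult mult.assoc simp flip: sum_distrib_left)
  also have "\<dots> = (\<integral>\<^sup>+x. ennreal (q * C * (\<Sum>j<n. H j x * X j x)) \<partial>M)"
    using q C H0 nonneg
    by (subst ennreal_mult) (auto intro!: sum_nonneg simp: nn_integral_cmult)
  also have "\<dots> \<le> (\<integral>\<^sup>+x. ennreal ((\<Sum>i<n. X i x) powr q / 2 + K / 2 * (\<Sum>j<n. X j x powr q)) \<partial>M)"
    unfolding H_def K_def using nonneg q C
    by (intro nn_integral_mono ennreal_leI increments_young) auto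
  also have "\<dots> = (\<integral>\<^sup>+x. ennreal (1 / 2) * ennreal ((\<Sum>i<n. X i x) powr q)
      + ennreal (K / 2) * ennreal (\<Sum>j<n. X j x powr q) \<partial>M)"
  proof (intro nn_integral_cong)
    show "ennreal ((\<Sum>i<n. X i x) powr q / 2 + K / 2 * (\<Sum>j<n. X j x powr q))
      = ennreal (1 / 2) * ennreal ((\<Sum>i<n. X i x) powr q) + ennreal (K / 2) * ennreal (\<Sum>j<n. X j x powr q)" for x
      by (intro halves sum_nonneg) auto
  qed
  also have "\<dots> = ennreal (1 / 2) * A + ennreal (K / 2) * B"
    unfolding A_def B_eq by (simp add: nn_integral_add nn_integral_cmult)
  finally have *: "A \<le> ennreal (1 / 2) * A + ennreal (K / 2) * B" .
  \<comment> \<open>Half of \<open>A\<close> can be subtracted only if \<open>A\<close> is finite.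
    This bound, whose constant depends on \<open>n\<close>, gives finiteness whenever
    \<open>B\<close> is finite and does not enter the final constant.\<close>
  have "A \<le> (\<integral>\<^sup>+x. ennreal (real n powr q * (\<Sum>j<n. X j x powr q)) \<partial>M)"
    unfolding A_def using nonneg q sum_powr_le_powr_sum[of "{..<n}" "\<lambda>i. X i x" q for x]
    by (intro nn_integral_mono ennreal_leI) auto
  also have "\<dots> = ennreal (real n powr q) * B"
    unfolding B_eq by (simp add: ennreal_mult sum_nonneg nn_integral_cmult)
  finally have A: "A \<le> ennreal (real n powr q) * B" .
  have "A \<le> ennreal K * B"
  proof (cases B)
    case (real b)
    with A have "A < top"
      by (metis ennreal_less_top le_less_trans ennreal_mult_less_top)
    then obtain a where a: "A = ennreal a" "0 \<le> a" by (cases A) auto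
    have "ennreal a \<le> ennreal (a / 2 + K / 2 * b)"
      using * a real halves[of a b] by (simp only:)
    then have "a \<le> a / 2 + K / 2 * b"
      using a real K by (subst (asm) ennreal_le_iff) auto
    then show ?thesis
      unfolding a real using a real K by (simp flip: ennreal_mult add: ennreal_le_iff)
  next
    case top
    with K show ?thesis by (simp add: ennreal_mult_top)
  qed
  then show ?thesis
    unfolding A_def B_def K_def .
qed

section \<open>Riesz potentials and dyadic levels\<close>

definition coarse :: "nat \<Rightarrow> ('n \<Rightarrow> int) \<Rightarrow> 'n \<Rightarrow> int" where
  "coarse l m = (\<lambda>i. m i div 2 ^ l)"

lemma idx_coarse': "idx k x = coarse l (idx (k + int l) x)"
  using idx_coarse[of "k + int l" l x] by (simp add: coarse_def fun_eq_iff)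

text \<open>Index offsets to a cube itself and to the cubes touching it, diagonal contact included;
  there are 3^n of them.\<close>

definition nbhd :: "('n \<Rightarrow> int) set" where
  "nbhd = {v. \<forall>i. v i \<in> {-1, 0, 1}}"

lemma finite_nbhd [simp]: "finite (nbhd :: ('n::finite \<Rightarrow> int) set)"
proof -
  have "(nbhd :: ('n \<Rightarrow> int) set) = PiE UNIV (\<lambda>_. {-1, 0, 1})"
    by (auto simp: nbhd_def PiE_def Pi_def)
  moreover have "finite (PiE (UNIV :: 'n set) (\<lambda>_. {-1, 0, 1 :: int}))"
    by (rule finite_PiE) auto
  ultimately show ?thesis by simp
qed

lemma card_nbhd_pos: "0 < card (nbhd :: ('n::finite \<Rightarrow> int) set)"
proof -
  have "(\<lambda>_. 0) \<in> (nbhd :: ('n \<Rightarrow> int) set)" by (simp add: nbhd_def)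
  then show ?thesis by (metis card_gt_0_iff empty_iff finite_nbhd)
qed

lemma idx_near:
  assumes "norm (x - y) < 2 powr (- real_of_int k)"
  shows "(\<lambda>i. idx k y i - idx k x i) \<in> nbhd"
proof -
  have "\<lfloor>2 powr k * y $ i\<rfloor> - \<lfloor>2 powr k * x $ i\<rfloor> \<in> {-1, 0, 1}" for i
  proof -
    have "\<bar>x $ i - y $ i\<bar> < 2 powr (- real_of_int k)"
      using component_le_norm_cart[of "x - y" i] assms by simp
    then have "2 powr k * \<bar>x $ i - y $ i\<bar> < 1"
      by (simp add: powr_minus field_simps)
    then have "\<bar>2 powr k * x $ i - 2 powr k * y $ i\<bar> < 1"
      by (simp add: abs_mult flip: right_diff_distrib)
    then have "\<bar>\<lfloor>2 powr k * y $ i\<rfloor> - \<lfloor>2 powr k * x $ i\<rfloor>\<bar> \<le> 1"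
      by linarith
    then show ?thesis by auto
  qed
  then show ?thesis by (simp add: nbhd_def idx_def)
qed

text \<open>Shifting a dividend by at most 1, hence by at most the divisor, moves the quotient by at
  most 1. Thus neighbours of a small cube lie inside neighbours of its ancestor.\<close>

lemma coarse_near:
  assumes "v \<in> nbhd"
  shows "(\<lambda>i. coarse l a i - coarse l (\<lambda>i. a i - v i) i) \<in> nbhd"
proof -
  have "b div c - (b - d) div c \<in> {-1, 0, 1}" if "d \<in> {-1, 0, 1}" "1 \<le> c" for b c d :: int
  proof -
    have "(b - c) div c \<le> (b - d) div c" "(b - d) div c \<le> (b + c) div c"
      using that zdiv_mono1[of "b - c" "b - d" c] zdiv_mono1[of "b - d" "b + c" c] by auto
    moreover have "(b - c) div c = b div c - 1" "(b + c) div c = b div c + 1"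
      using that div_add_self2[of c "b - c"] by auto
    ultimately show ?thesis by auto
  qed
  then show ?thesis
    using assms by (auto simp: nbhd_def coarse_def)
qed

text \<open>The weight is later |f|; local integrability gives the finiteness that makes the masses
  of cubes real numbers.\<close>

locale dyadic_mass =
  fixes w :: "real^'n \<Rightarrow> ennreal"
  assumes w_measurable [measurable]: "w \<in> borel_measurable lebesgue"
    and finite_on_cubes: "(\<integral>\<^sup>+x\<in>cube k m. w x \<partial>lebesgue) < top"
begin

definition mass :: "int \<Rightarrow> ('n \<Rightarrow> int) \<Rightarrow> real" where
  "mass k m = enn2real (\<integral>\<^sup>+x\<in>cube k m. w x \<partial>lebesgue)"

lemma mass_nonneg [simp]: "0 \<le> mass k m"
  by (simp add: mass_def)

lemma ennreal_mass: "(\<integral>\<^sup>+x\<in>cube k m. w x \<partial>lebesgue) = ennreal (mass k m)"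
  using finite_on_cubes[of k m] by (simp add: mass_def)

lemma nn_integral_idx_mass:
  "(\<integral>\<^sup>+x. h (idx k x) * w x \<partial>lebesgue) = (\<integral>\<^sup>+m. h m * ennreal (mass k m) \<partial>count_space UNIV)"
  by (simp add: nn_integral_idx ennreal_mass)

definition nmass :: "int \<Rightarrow> ('n \<Rightarrow> int) \<Rightarrow> real" where
  "nmass k m = (\<Sum>v\<in>nbhd. mass k (\<lambda>i. m i + v i))"

lemma nmass_nonneg [simp]: "0 \<le> nmass k m"
  by (simp add: nmass_def sum_nonneg)

lemma ennreal_nmass:
  "ennreal (nmass k m) = (\<integral>\<^sup>+y. (\<Sum>v\<in>nbhd. indicator (cube k (\<lambda>i. m i + v i)) y) * w y \<partial>lebesgue)"
proof -
  have "(\<integral>\<^sup>+y. (\<Sum>v\<in>nbhd. indicator (cube k (\<lambda>i. m i + v i)) y) * w y \<partial>lebesgue)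
      = (\<integral>\<^sup>+y. (\<Sum>v\<in>nbhd. w y * indicator (cube k (\<lambda>i. m i + v i)) y) \<partial>lebesgue)"
    by (simp only: sum_distrib_right mult.commute[of "w _"])
  also have "\<dots> = (\<Sum>v\<in>nbhd. ennreal (mass k (\<lambda>i. m i + v i)))"
    by (subst nn_integral_sum) (auto simp: ennreal_mass)
  finally show ?thesis
    by (simp add: nmass_def)
qed

text \<open>The function \<open>X\<^sub>k\<close> of the overview: the size of the kernel at
  distance about \<open>2 powr (-k)\<close> times the mass near \<open>x\<close> at that
  scale.\<close>

definition riesz_level :: "real \<Rightarrow> int \<Rightarrow> real^'n \<Rightarrow> real" where
  "riesz_level lam k x = 2 powr (real_of_int k * (real CARD('n) - lam)) * nmass k (idx k x)"

lemma riesz_level_nonneg [simp]: "0 \<le> riesz_level lam k x"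
  by (simp add: riesz_level_def)

lemma riesz_level_measurable [measurable]: "riesz_level lam k \<in> borel_measurable lebesgue"
  unfolding riesz_level_def by measurable

text \<open>Decompose space into the shells 2^(-k-1) \<le> |x - y| < 2^(-k). A point of such a shell
  lies in a neighbour of the cube of \<open>x\<close> at scale \<open>k\<close>, and the inner
  radius accounts for the factor 2^(n-lam).\<close>

lemma riesz_le_levels:
  assumes "lam < real CARD('n)"
  shows "(\<integral>\<^sup>+y. w y * ennreal (norm (x - y) powr (lam - real CARD('n))) \<partial>lebesgue)
    \<le> ennreal (2 powr (real CARD('n) - lam)) * (\<integral>\<^sup>+k. ennreal (riesz_level lam k x) \<partial>count_space UNIV)"
proof -
  define d where "d = real CARD('n) - lam"
  have d: "0 < d" using assms by (simp add: d_def)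
  define g where "g k y = ennreal (2 powr d * 2 powr (real_of_int k * d)) *
     ((\<Sum>v\<in>nbhd. indicator (cube k (\<lambda>i. idx k x i + v i)) y) * w y)" for k y
  have "w y * ennreal (norm (x - y) powr (lam - real CARD('n))) \<le> (\<integral>\<^sup>+k. g k y \<partial>count_space UNIV)" for y
  \<comment> \<open>On the diagonal the kernel is \<open>0 powr _\<close>, which is 0, so the bound
    is trivial there.\<close>
  proof (cases "x = y")
    case False
    define r where "r = norm (x - y)"
    have "0 < r" using False by (simp add: r_def)
    \<comment> \<open>Ceiling minus one makes the outer bound on the shell strict, as
      \<open>idx_near\<close> requires.\<close>
    define k where "k = \<lceil>- log 2 r\<rceil> - 1"
    have k: "- real_of_int k - 1 \<le> log 2 r" "log 2 r < - real_of_int k"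
      unfolding k_def by linarith+
    have r: "2 powr (- real_of_int k - 1) \<le> r" "r < 2 powr (- real_of_int k)"
      using k \<open>0 < r\<close> by (simp_all add: powr_le_iff less_powr_iff)
    have "r powr (- d) \<le> (2 powr (- real_of_int k - 1)) powr (- d)"
      using r d by (intro powr_mono2') auto
    also have "\<dots> = 2 powr d * 2 powr (real_of_int k * d)"
      by (simp add: powr_powr algebra_simps flip: powr_add)
    finally have 1: "norm (x - y) powr (lam - real CARD('n)) \<le> 2 powr d * 2 powr (real_of_int k * d)"
      by (simp add: r_def d_def)
    let ?v = "\<lambda>i. idx k y i - idx k x i"
    have "?v \<in> nbhd"
      using r(2) unfolding r_def by (rule idx_near)
    moreover have "y \<in> cube k (\<lambda>i. idx k x i + ?v i)"
      by (simp add: mem_cube)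
    ultimately have "1 \<le> (\<Sum>v\<in>nbhd. indicator (cube k (\<lambda>i. idx k x i + v i)) y :: ennreal)"
      using member_le_sum[of ?v nbhd "\<lambda>v. indicator (cube k (\<lambda>i. idx k x i + v i)) y :: ennreal"] by simp
    then have "w y \<le> (\<Sum>v\<in>nbhd. indicator (cube k (\<lambda>i. idx k x i + v i)) y) * w y"
      using mult_right_mono[of 1 _ "w y"] by simp
    then have "w y * ennreal (norm (x - y) powr (lam - real CARD('n))) \<le> g k y"
      unfolding g_def using 1 by (subst mult.commute) (intro mult_mono ennreal_leI, auto)
    also have "g k y \<le> (\<integral>\<^sup>+k. g k y \<partial>count_space UNIV)"
      by (rule nn_integral_ge_point) simp
    finally show ?thesis .
  qed simp
  then have "(\<integral>\<^sup>+y. w y * ennreal (norm (x - y) powr (lam - real CARD('n))) \<partial>lebesgue)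
      \<le> (\<integral>\<^sup>+y. (\<integral>\<^sup>+k. g k y \<partial>count_space UNIV) \<partial>lebesgue)"
    by (rule nn_integral_mono)
  also have "\<dots> = (\<integral>\<^sup>+k. (\<integral>\<^sup>+y. g k y \<partial>lebesgue) \<partial>count_space UNIV)"
    unfolding g_def by (rule nn_integral_count_space_nn_integral) auto
  also have "(\<lambda>k. \<integral>\<^sup>+y. g k y \<partial>lebesgue) = (\<lambda>k. ennreal (2 powr d) * ennreal (riesz_level lam k x))"
    unfolding g_def
    by (simp add: nn_integral_cmult ennreal_nmass[symmetric] riesz_level_def d_def mult.assoc ennreal_mult')
  also have "(\<integral>\<^sup>+k. ennreal (2 powr d) * ennreal (riesz_level lam k x) \<partial>count_space UNIV)
      = ennreal (2 powr d) * (\<integral>\<^sup>+k. ennreal (riesz_level lam k x) \<partial>count_space UNIV)"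
    by (rule nn_integral_cmult) simp
  finally show ?thesis
    unfolding d_def .
qed

text \<open>After reindexing by the shifted cubes, the sum is the mass of a union of distinct cubes
  of scale \<open>j + l\<close>. By \<open>coarse_near\<close> their ancestors at scale
  \<open>j\<close> are neighbours of \<open>m\<close>.\<close>

lemma shifted_mass_sum_le:
  assumes "v \<in> nbhd"
  shows "(\<integral>\<^sup>+m'. (if coarse l m' = m then ennreal (mass (j + int l) (\<lambda>i. m' i + v i)) else 0) \<partial>count_space UNIV)
    \<le> ennreal (nmass j m)"
proof -
  have "bij_betw (\<lambda>m' i. m' i + v i) UNIV UNIV"
    by (rule bij_betwI[where g = "\<lambda>m' i. m' i - v i"]) auto
  then have "(\<integral>\<^sup>+m'. (\<lambda>m''. (if coarse l (\<lambda>i. m'' i - v i) = m then 1 else 0)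
        * ennreal (mass (j + int l) m'')) (\<lambda>i. m' i + v i) \<partial>count_space UNIV)
      = (\<integral>\<^sup>+m''. (if coarse l (\<lambda>i. m'' i - v i) = m then 1 else 0)
        * ennreal (mass (j + int l) m'') \<partial>count_space UNIV)"
    by (rule nn_integral_bij_count_space)
  then have "(\<integral>\<^sup>+m'. (if coarse l m' = m then ennreal (mass (j + int l) (\<lambda>i. m' i + v i)) else 0) \<partial>count_space UNIV)
      = (\<integral>\<^sup>+m''. (if coarse l (\<lambda>i. m'' i - v i) = m then 1 else 0)
        * ennreal (mass (j + int l) m'') \<partial>count_space UNIV)"
    by (simp add: if_distrib if_distribR cong: if_cong)
  also have "\<dots> = (\<integral>\<^sup>+y. (if coarse l (\<lambda>i. idx (j + int l) y i - v i) = m then 1 else 0) * w y \<partial>lebesgue)"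
    by (subst nn_integral_idx_mass) simp
  also have "\<dots> \<le> (\<integral>\<^sup>+y. (\<Sum>u\<in>nbhd. indicator (cube j (\<lambda>i. m i + u i)) y) * w y \<partial>lebesgue)"
  proof (intro nn_integral_mono mult_right_mono)
    fix y
    show "(if coarse l (\<lambda>i. idx (j + int l) y i - v i) = m then 1 else 0)
        \<le> (\<Sum>u\<in>nbhd. indicator (cube j (\<lambda>i. m i + u i)) y :: ennreal)"
    proof (cases "coarse l (\<lambda>i. idx (j + int l) y i - v i) = m")
      case True
      let ?u = "\<lambda>i. idx j y i - m i"
      have "?u \<in> nbhd"
        using coarse_near[OF assms, of l "idx (j + int l) y"] True idx_coarse'[of j y l] by simp
      moreover have "y \<in> cube j (\<lambda>i. m i + ?u i)"
        by (simp add: mem_cube)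
      ultimately show ?thesis
        using True member_le_sum[of ?u nbhd "\<lambda>u. indicator (cube j (\<lambda>i. m i + u i)) y :: ennreal"] by simp
    qed simp
  qed simp
  finally show ?thesis
    by (simp add: ennreal_nmass)
qed

text \<open>With k = j + l, volume times kernel size leaves 2^(-k lam) in front of a sum of
  neighbour masses. Each of the \<open>card nbhd\<close> offsets contributes at most
  \<open>nmass j m\<close>, and 2^(-k lam) splits into 2^(-j lam) and the l-th power of
  2^(-lam).\<close>

lemma riesz_level_decay:
  "(\<integral>\<^sup>+x\<in>cube j m. ennreal (riesz_level lam (j + int l) x) \<partial>lebesgue)
    \<le> ennreal (real (card (nbhd :: ('n \<Rightarrow> int) set)) * (2 powr (- lam)) ^ l * (2 powr (- real_of_int j * lam) * nmass j m))"
proof -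
  let ?k = "j + int l"
  define c where "c = 2 powr (real_of_int ?k * (real CARD('n) - lam))"
  have "(\<integral>\<^sup>+x\<in>cube j m. ennreal (riesz_level lam ?k x) \<partial>lebesgue)
    = (\<integral>\<^sup>+x. (\<lambda>m'. ennreal c * (if coarse l m' = m then ennreal (nmass ?k m') else 0)) (idx ?k x) \<partial>lebesgue)"
    by (intro nn_integral_cong)
      (auto simp: indicator_def mem_cube riesz_level_def c_def ennreal_mult idx_coarse'[of j _ l])
  also have "\<dots> = ennreal (2 powr (- real_of_int ?k * real CARD('n))) *
      (ennreal c * (\<integral>\<^sup>+m'. (if coarse l m' = m then ennreal (nmass ?k m') else 0) \<partial>count_space UNIV))"
    by (subst nn_integral_idx_1) (simp add: nn_integral_cmult)
  also have "\<dots> = ennreal (2 powr (- real_of_int ?k * lam)) *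
      (\<integral>\<^sup>+m'. (if coarse l m' = m then ennreal (nmass ?k m') else 0) \<partial>count_space UNIV)"
    unfolding c_def mult.assoc[symmetric]
    by (subst ennreal_mult[symmetric]) (auto simp: algebra_simps simp flip: powr_add)
  also have "(\<integral>\<^sup>+m'. (if coarse l m' = m then ennreal (nmass ?k m') else 0) \<partial>count_space UNIV)
      = (\<integral>\<^sup>+m'. (\<Sum>v\<in>nbhd. if coarse l m' = m then ennreal (mass ?k (\<lambda>i. m' i + v i)) else 0) \<partial>count_space UNIV)"
    by (intro nn_integral_cong) (auto simp: nmass_def)
  also have "\<dots> = (\<Sum>v\<in>nbhd. \<integral>\<^sup>+m'. (if coarse l m' = m then ennreal (mass ?k (\<lambda>i. m' i + v i)) else 0) \<partial>count_space UNIV)"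
    by (rule nn_integral_sum) simp
  also have "ennreal (2 powr (- real_of_int ?k * lam)) * \<dots>
      \<le> ennreal (2 powr (- real_of_int ?k * lam)) * (\<Sum>v\<in>(nbhd :: ('n \<Rightarrow> int) set). ennreal (nmass j m))"
    by (intro mult_left_mono sum_mono shifted_mass_sum_le) auto
  also have "\<dots> = ennreal (2 powr (- real_of_int ?k * lam) * (real (card (nbhd :: ('n \<Rightarrow> int) set)) * nmass j m))"
    by (simp add: ennreal_mult ennreal_of_nat_eq_real_of_nat)
  also have "2 powr (- real_of_int ?k * lam) = (2 powr (- lam)) ^ l * 2 powr (- real_of_int j * lam)"
    by (simp add: powr_powr algebra_simps flip: powr_add powr_realpow)
  finally show ?thesis
    by (simp add: mult_ac)
qed

end

section \<open>Wolff's inequality\<close>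

text \<open>Windows of scales from -N to N - 1, numbered from 0, turn the two-sided sum into a limit
  of finite sequences with a first term.\<close>

lemma nn_integral_count_space_int_SUP:
  fixes f :: "int \<Rightarrow> ennreal"
  shows "(\<integral>\<^sup>+k. f k \<partial>count_space UNIV) = (SUP N. \<Sum>i<2 * N. f (int i - int N))"
proof -
  have "(\<Sum>i<2 * N. f (int i - int N)) = (\<integral>\<^sup>+k. f k * indicator {- int N..<int N} k \<partial>count_space UNIV)" for N
  proof -
    have "bij_betw (\<lambda>i. int i - int N) {..<2 * N} {- int N..<int N}"
      by (rule bij_betwI[where g = "\<lambda>k. nat (k + int N)"]) auto
    then have "(\<Sum>i<2 * N. f (int i - int N)) = (\<Sum>k\<in>{- int N..<int N}. f k)"
      by (rule sum.reindex_bij_betw)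
    then show ?thesis
      by (simp add: nn_integral_count_space_indicator[symmetric] nn_integral_count_space_finite)
  qed
  moreover have "(SUP N. \<integral>\<^sup>+k. f k * indicator {- int N..<int N} k \<partial>count_space UNIV)
      = (\<integral>\<^sup>+k. (SUP N. f k * indicator {- int N..<int N} k) \<partial>count_space UNIV)"
    by (intro nn_integral_monotone_convergence_SUP[symmetric])
      (auto simp: incseq_def le_fun_def indicator_def)
  moreover have "(SUP N. f k * indicator {- int N..<int N} k) = f k" for k
  proof (rule antisym)
    show "f k \<le> (SUP N. f k * indicator {- int N..<int N} k)"
      by (rule SUP_upper2[of "nat \<bar>k\<bar> + 1"]) (auto simp: indicator_def)
  qed (auto intro!: SUP_least simp: indicator_def)
  ultimately show ?thesis by simp
qed

context dyadic_mass
begin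

text \<open>The term that the cube contributes to the sparse norm, since |Q|^(-(1-1/p)) = 2^(k n
  (1-1/p)); \<open>epowr_cube_term\<close> makes the identification.\<close>

definition coef :: "real \<Rightarrow> real \<Rightarrow> int \<Rightarrow> ('n \<Rightarrow> int) \<Rightarrow> real" where
  "coef p q k m = (2 powr (real_of_int k * (real CARD('n) * (1 - 1 / p))) * mass k m) powr q"

lemma coef_nonneg [simp]: "0 \<le> coef p q k m"
  by (simp add: coef_def)

definition energy :: "real \<Rightarrow> real \<Rightarrow> ennreal" where
  "energy p q = (\<integral>\<^sup>+k. \<integral>\<^sup>+m. ennreal (coef p q k m) \<partial>count_space UNIV \<partial>count_space UNIV)"

text \<open>Geometric series of ratio 2^(-lam) over the finer scales. The right side is a constant
  times the integral of the level \<open>k\<close> itself over the cube, because |Q| 2^(k(n-lam)) =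
  2^(-k lam).\<close>

lemma riesz_level_future:
  assumes lam: "0 < lam"
  shows "(\<integral>\<^sup>+x\<in>cube k m. ennreal (\<Sum>l<N. riesz_level lam (k + int l) x) \<partial>lebesgue)
    \<le> ennreal (real (card (nbhd :: ('n \<Rightarrow> int) set)) / (1 - 2 powr (- lam)) * (2 powr (- real_of_int k * lam) * nmass k m))"
proof -
  define r where "r = 2 powr (- lam)"
  have r: "0 < r" "r < 1"
    using lam powr_less_mono[of "- lam" 0 2] by (auto simp: r_def)
  define a where "a = 2 powr (- real_of_int k * lam) * nmass k m"
  have a: "0 \<le> a" by (simp add: a_def)
  define c where "c = real (card (nbhd :: ('n \<Rightarrow> int) set))"
  have c: "0 < c" using card_nbhd_pos[where 'n='n] by (simp add: c_def)
  have "(\<integral>\<^sup>+x\<in>cube k m. ennreal (\<Sum>l<N. riesz_level lam (k + int l) x) \<partial>lebesgue)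
      = (\<Sum>l<N. \<integral>\<^sup>+x\<in>cube k m. ennreal (riesz_level lam (k + int l) x) \<partial>lebesgue)"
    by (subst nn_integral_sum[symmetric]) (auto simp: sum_distrib_right simp flip: sum_ennreal)
  also have "\<dots> \<le> (\<Sum>l<N. ennreal (c * r ^ l * a))"
    unfolding c_def r_def a_def by (intro sum_mono riesz_level_decay)
  also have "\<dots> = ennreal (c * (\<Sum>l<N. r ^ l) * a)"
    using a c r by (simp add: sum_ennreal sum_distrib_left sum_distrib_right)
  also have "\<dots> \<le> ennreal (c * (1 / (1 - r)) * a)"
  proof (intro ennreal_leI mult_right_mono mult_left_mono a)
    have "(\<Sum>l<N. r ^ l) \<le> (\<Sum>l. r ^ l)"
      using r by (intro sum_le_suminf summable_geometric) auto
    then show "(\<Sum>l<N. r ^ l) \<le> 1 / (1 - r)"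
      using r by (simp add: suminf_geometric)
  qed (use c in auto)
  finally show ?thesis
    by (simp add: c_def a_def r_def)
qed

text \<open>The choice of \<open>lam\<close> is exactly what makes -kn + k(n-lam)q equal to k n
  (1-1/p) q, so volume times the q-th power gives \<open>coef\<close>. With c =
  \<open>card nbhd\<close>, splitting the q-th power of a neighbour mass costs c^q, and the c
  translated lattice sums, all equal, cost one more factor c.\<close>

lemma riesz_level_powr:
  assumes q: "0 < q" and lam: "lam = real CARD('n) * (1 / p - 1 / q)"
  shows "(\<integral>\<^sup>+x. ennreal (riesz_level lam k x powr q) \<partial>lebesgue)
    \<le> ennreal (real (card (nbhd :: ('n \<Rightarrow> int) set)) powr (q + 1)) * (\<integral>\<^sup>+m. ennreal (coef p q k m) \<partial>count_space UNIV)"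
proof -
  define c where "c = real (card (nbhd :: ('n \<Rightarrow> int) set))"
  have c: "0 < c" using card_nbhd_pos[where 'n='n] by (simp add: c_def)
  define b where "b = 2 powr (real_of_int k * (real CARD('n) - lam))"
  define s where "s = 2 powr (- real_of_int k * real CARD('n))"
  have coef: "s * (b powr q * mass k m powr q) = coef p q k m" for m
  proof -
    have "- real_of_int k * real CARD('n) + real_of_int k * (real CARD('n) - lam) * q
        = real_of_int k * (real CARD('n) * (1 - 1 / p)) * q"
      using q unfolding lam by (simp add: field_simps)
    then have "s * b powr q = (2 powr (real_of_int k * (real CARD('n) * (1 - 1 / p)))) powr q"
      unfolding s_def b_def powr_powr by (simp only: powr_add[symmetric])
    then show ?thesis
      by (simp add: coef_def powr_mult mult.assoc[symmetric])
  qed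
  have shift: "(\<integral>\<^sup>+m. ennreal (coef p q k (\<lambda>i. m i + v i)) \<partial>count_space UNIV)
      = (\<integral>\<^sup>+m. ennreal (coef p q k m) \<partial>count_space UNIV)" for v :: "'n \<Rightarrow> int"
  proof -
    have "bij_betw (\<lambda>m' i. m' i + v i) UNIV UNIV"
      by (rule bij_betwI[where g = "\<lambda>m' i. m' i - v i"]) auto
    then show ?thesis
      by (rule nn_integral_bij_count_space[where f = "\<lambda>m. ennreal (coef p q k m)"])
  qed
  have "(\<integral>\<^sup>+x. ennreal (riesz_level lam k x powr q) \<partial>lebesgue)
      = ennreal s * (\<integral>\<^sup>+m. ennreal ((b * nmass k m) powr q) \<partial>count_space UNIV)"
    unfolding riesz_level_def b_def s_def by (rule nn_integral_idx_1)
  also have "\<dots> = (\<integral>\<^sup>+m. ennreal (s * (b * nmass k m) powr q) \<partial>count_space UNIV)"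
    by (simp add: s_def ennreal_mult nn_integral_cmult)
  also have "\<dots> \<le> (\<integral>\<^sup>+m. ennreal (c powr q) * (\<Sum>v\<in>nbhd. ennreal (coef p q k (\<lambda>i. m i + v i))) \<partial>count_space UNIV)"
  proof (rule nn_integral_mono)
    fix m :: "'n \<Rightarrow> int"
    have "nmass k m powr q \<le> c powr q * (\<Sum>v\<in>nbhd. mass k (\<lambda>i. m i + v i) powr q)"
      unfolding nmass_def c_def using q by (intro sum_powr_le_powr_sum) auto
    then have "s * (b powr q * nmass k m powr q)
        \<le> s * (b powr q * (c powr q * (\<Sum>v\<in>nbhd. mass k (\<lambda>i. m i + v i) powr q)))"
      by (intro mult_left_mono) (auto simp: s_def)
    also have "\<dots> = c powr q * (\<Sum>v\<in>nbhd. coef p q k (\<lambda>i. m i + v i))"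
      unfolding coef[symmetric] sum_distrib_left by (simp add: mult_ac)
    finally show "ennreal (s * (b * nmass k m) powr q)
        \<le> ennreal (c powr q) * (\<Sum>v\<in>nbhd. ennreal (coef p q k (\<lambda>i. m i + v i)))"
      by (simp add: powr_mult b_def sum_nonneg sum_ennreal ennreal_leI flip: ennreal_mult)
  qed
  also have "\<dots> = ennreal (c powr q) * (\<Sum>v\<in>(nbhd :: ('n \<Rightarrow> int) set). \<integral>\<^sup>+m. ennreal (coef p q k m) \<partial>count_space UNIV)"
    by (simp add: nn_integral_cmult nn_integral_sum shift del: sum_ennreal)
  also have "\<dots> = ennreal (c powr (q + 1)) * (\<integral>\<^sup>+m. ennreal (coef p q k m) \<partial>count_space UNIV)"
    using c by (simp add: powr_add ennreal_mult mult.assoc c_def ennreal_of_nat_eq_real_of_nat)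
  finally show ?thesis
    by (simp add: c_def)
qed

text \<open>The Garsia--Neveu inequality for the dyadic filtration, with scale as time. The shift
  \<open>a\<close> lets time 0 stand for an arbitrarily coarse scale without affecting the
  constant.\<close>

lemma riesz_levels_powr:
  assumes q: "1 < q" and lam: "0 < lam"
  shows "(\<integral>\<^sup>+x. ennreal ((\<Sum>i<n. riesz_level lam (int i - a) x) powr q) \<partial>lebesgue)
    \<le> ennreal ((2 * (q * (real (card (nbhd :: ('n \<Rightarrow> int) set)) / (1 - 2 powr (- lam))))) powr q)
      * (\<Sum>i<n. \<integral>\<^sup>+x. ennreal (riesz_level lam (int i - a) x powr q) \<partial>lebesgue)"
proof (rule nn_integral_sum_powr_le)
  let ?C = "real (card (nbhd :: ('n \<Rightarrow> int) set)) / (1 - 2 powr (- lam))"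
  have "2 powr (- lam) < 1"
    using lam powr_less_mono[of "- lam" 0 2] by auto
  then show C: "0 < ?C"
    using card_nbhd_pos[where 'n='n] by simp
  fix j assume "j < n"
  let ?X = "\<lambda>i. riesz_level lam (int i - a)"
  let ?k = "int j - a"
  define H where "H = (\<lambda>x. (\<Sum>i<Suc j. ?X i x) powr (q - 1) - (\<Sum>i<j. ?X i x) powr (q - 1))"
  have H0: "0 \<le> H x" for x
    unfolding H_def using q by (intro partial_sum_powr_increment_nonneg) auto
  \<comment> \<open>Indices at coarser scales are functions of the index at scale \<open>?k\<close>,
    so all levels up to \<open>j\<close>, and with them \<open>H\<close>, are constant on cubes of
    that scale. Hence \<open>H\<close> can be pulled out of the integral over each cube.\<close>
  have "idx ?k x = idx ?k y \<Longrightarrow> H x = H y" for x y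
  proof -
    assume *: "idx ?k x = idx ?k y"
    have "?X i x = ?X i y" if "i \<le> j" for i
    proof -
      have "int i - a + int (j - i) = ?k" using that by simp
      then have "idx (int i - a) x = idx (int i - a) y"
        using * idx_coarse'[of "int i - a" _ "j - i"] by metis
      then show ?thesis by (simp add: riesz_level_def)
    qed
    then show "H x = H y"
      unfolding H_def by (intro arg_cong2[where f = "(-)"] arg_cong2[where f = "(powr)"] sum.cong) auto
  qed
  then have "\<exists>h. \<forall>x. H x = h (idx ?k x)"
    by (intro exI[of _ "\<lambda>m. H (SOME x. idx ?k x = m)"] allI) (metis (mono_tags, lifting) someI)
  then obtain h where h: "\<And>x. H x = h (idx ?k x)" by blast
  have U: "(\<Sum>i=j..<n. ?X i x) = (\<Sum>l<n - j. riesz_level lam (?k + int l) x)" for x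
  proof -
    have "(\<Sum>i=j..<n. ?X i x) = (\<Sum>l<n - j. ?X (l + j) x)"
      using sum.shift_bounds_nat_ivl[of "\<lambda>i. ?X i x" 0 j "n - j"] \<open>j < n\<close>
      by (simp add: lessThan_atLeast0)
    then show ?thesis
      by (simp add: algebra_simps)
  qed
  have "(\<integral>\<^sup>+x. ennreal (H x * (\<Sum>i=j..<n. ?X i x)) \<partial>lebesgue)
      = (\<integral>\<^sup>+x. ennreal (h (idx ?k x)) * ennreal (\<Sum>l<n - j. riesz_level lam (?k + int l) x) \<partial>lebesgue)"
    unfolding U h[symmetric] using H0 by (simp add: ennreal_mult sum_nonneg)
  also have "\<dots> = (\<integral>\<^sup>+m. ennreal (h m) *
      (\<integral>\<^sup>+x\<in>cube ?k m. ennreal (\<Sum>l<n - j. riesz_level lam (?k + int l) x) \<partial>lebesgue) \<partial>count_space UNIV)"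
    by (rule nn_integral_idx) simp
  also have "\<dots> \<le> (\<integral>\<^sup>+m. ennreal (h m) * ennreal (?C * (2 powr (- real_of_int ?k * lam) * nmass ?k m)) \<partial>count_space UNIV)"
    by (intro nn_integral_mono mult_left_mono riesz_level_future lam) auto
  also have "\<dots> = ennreal ?C * (ennreal (2 powr (- real_of_int ?k * real CARD('n))) *
      (\<integral>\<^sup>+m. ennreal (h m) * ennreal (2 powr (real_of_int ?k * (real CARD('n) - lam)) * nmass ?k m) \<partial>count_space UNIV))"
  proof -
    \<comment> \<open>Volume of the cube times kernel size: this turns the bound on the future
      levels back into an integral of the level \<open>j\<close>.\<close>
    have split: "2 powr (- real_of_int ?k * lam)
        = 2 powr (- real_of_int ?k * real CARD('n)) * 2 powr (real_of_int ?k * (real CARD('n) - lam))"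
      by (simp add: algebra_simps flip: powr_add)
    have "ennreal (h m) * ennreal (c * (s * b * nmass ?k m))
        = ennreal c * (ennreal s * (ennreal (h m) * ennreal (b * nmass ?k m)))"
      if "0 < c" "0 \<le> s" "0 \<le> b" for c s b m
      using that by (simp add: ennreal_mult mult_ac)
    from this[OF C] show ?thesis
      unfolding split by (simp only: nn_integral_cmult powr_ge_zero borel_measurable_count_space)
  qed
  also have "\<dots> = ennreal ?C * (\<integral>\<^sup>+x. ennreal (H x * ?X j x) \<partial>lebesgue)"
    using H0 by (subst nn_integral_idx_1[symmetric]) (simp add: h[symmetric] riesz_level_def ennreal_mult')
  finally show "(\<integral>\<^sup>+x. ennreal (((\<Sum>i<Suc j. ?X i x) powr (q - 1) - (\<Sum>i<j. ?X i x) powr (q - 1)) * (\<Sum>i=j..<n. ?X i x)) \<partial>lebesgue)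
     \<le> ennreal ?C * (\<integral>\<^sup>+x. ennreal (((\<Sum>i<Suc j. ?X i x) powr (q - 1) - (\<Sum>i<j. ?X i x) powr (q - 1)) * ?X j x) \<partial>lebesgue)"
    unfolding H_def .
qed (use q in auto)

lemma riesz_levels_energy:
  assumes q: "1 < q" and pq: "1 / q < 1 / p" and lam: "lam = real CARD('n) * (1 / p - 1 / q)"
  shows "(\<integral>\<^sup>+x. epowr (\<integral>\<^sup>+k. ennreal (riesz_level lam k x) \<partial>count_space UNIV) q \<partial>lebesgue)
    \<le> ennreal ((2 * (q * (real (card (nbhd :: ('n \<Rightarrow> int) set)) / (1 - 2 powr (- lam))))) powr q
        * real (card (nbhd :: ('n \<Rightarrow> int) set)) powr (q + 1)) * energy p q"
proof -
  have lam0: "0 < lam"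
    using pq by (simp add: lam)
  define K where "K = (2 * (q * (real (card (nbhd :: ('n \<Rightarrow> int) set)) / (1 - 2 powr (- lam))))) powr q"
  define L where "L = real (card (nbhd :: ('n \<Rightarrow> int) set)) powr (q + 1)"
  define S where "S N x = (\<Sum>i<2 * N. riesz_level lam (int i - int N) x)" for N x
  have S0: "0 \<le> S N x" for N x
    by (simp add: S_def sum_nonneg)
  have [measurable]: "S N \<in> borel_measurable lebesgue" for N
    unfolding S_def by measurable
  have inc: "incseq (\<lambda>N. S N x)" for x
  proof (rule incseq_SucI)
    fix N
    \<comment> \<open>Enlarging the window adds a scale at each end, so position \<open>i\<close> in
      the old window is position \<open>Suc i\<close> in the new one.\<close>
    have "(\<Sum>i<2 * N. riesz_level lam (int i - int N) x)
        = (\<Sum>i\<in>Suc ` {..<2 * N}. riesz_level lam (int i - int (Suc N)) x)"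
      by (subst sum.reindex) auto
    also have "\<dots> \<le> S (Suc N) x"
      unfolding S_def by (intro sum_mono2) auto
    finally show "S N x \<le> S (Suc N) x"
      by (simp add: S_def)
  qed
  have "(\<integral>\<^sup>+x. epowr (\<integral>\<^sup>+k. ennreal (riesz_level lam k x) \<partial>count_space UNIV) q \<partial>lebesgue)
      = (\<integral>\<^sup>+x. epowr (SUP N. ennreal (S N x)) q \<partial>lebesgue)"
    by (simp add: nn_integral_count_space_int_SUP S_def)
  also have "\<dots> \<le> (\<integral>\<^sup>+x. (SUP N. epowr (ennreal (S N x)) q) \<partial>lebesgue)"
    using q by (intro nn_integral_mono epowr_SUP_le) auto
  also have "\<dots> = (SUP N. \<integral>\<^sup>+x. epowr (ennreal (S N x)) q \<partial>lebesgue)"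
    using inc q by (intro nn_integral_monotone_convergence_SUP)
      (auto simp: incseq_def le_fun_def intro!: epowr_mono ennreal_leI)
  also have "\<dots> \<le> ennreal (K * L) * energy p q"
  proof (rule SUP_least)
    fix N
    have "(\<integral>\<^sup>+x. epowr (ennreal (S N x)) q \<partial>lebesgue) = (\<integral>\<^sup>+x. ennreal (S N x powr q) \<partial>lebesgue)"
      by (simp add: S0)
    also have "\<dots> \<le> ennreal K * (\<Sum>i<2 * N. \<integral>\<^sup>+x. ennreal (riesz_level lam (int i - int N) x powr q) \<partial>lebesgue)"
      unfolding S_def K_def by (rule riesz_levels_powr[OF q lam0])
    also have "\<dots> \<le> ennreal K * (\<Sum>i<2 * N. ennreal L * (\<integral>\<^sup>+m. ennreal (coef p q (int i - int N) m) \<partial>count_space UNIV))"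
      unfolding L_def using q by (intro mult_left_mono sum_mono riesz_level_powr lam) auto
    also have "\<dots> = ennreal (K * L) * (\<Sum>i<2 * N. \<integral>\<^sup>+m. ennreal (coef p q (int i - int N) m) \<partial>count_space UNIV)"
      by (simp add: K_def L_def ennreal_mult mult.assoc sum_distrib_left)
    also have "\<dots> \<le> ennreal (K * L) * energy p q"
      unfolding energy_def nn_integral_count_space_int_SUP[where f = "\<lambda>k. \<integral>\<^sup>+m. ennreal (coef p q k m) \<partial>count_space UNIV"]
      by (intro mult_left_mono SUP_upper) auto
    finally show "(\<integral>\<^sup>+x. epowr (ennreal (S N x)) q \<partial>lebesgue) \<le> ennreal (K * L) * energy p q" .
  qed
  finally show ?thesis
    by (simp add: K_def L_def)
qed

end

section \<open>Sparse domination of the dyadic energy\<close>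

lemma coarse_coarse: "coarse l' (coarse l m) = coarse (l + l') m"
  by (simp add: coarse_def power_add zdiv_zmult2_eq)

lemma coarse_0 [simp]: "coarse 0 m = m"
  by (simp add: coarse_def)

lemma idx_pred_measurable [measurable]: "Measurable.pred lebesgue (\<lambda>x. P (idx k x))"
  by (rule measurable_compose[OF idx_measurable]) simp

definition sparse_cubes :: "(int \<times> ('n::finite \<Rightarrow> int)) set \<Rightarrow> bool" where
  "sparse_cubes S \<longleftrightarrow> (\<exists>E. (\<forall>(k, m)\<in>S. E (k, m) \<in> sets lebesgue \<and> E (k, m) \<subseteq> cube k m \<and>
      measure lebesgue (E (k, m)) \<ge> measure lebesgue (cube k m) / 2) \<and> disjoint_family_on E S)"

text \<open>Testing the sparse norm on single cubes bounds each \<open>coef\<close>, from which the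
  decay of averages along ancestors follows.\<close>

lemma sparse_cubes_singleton: "sparse_cubes {(k, m)}"
  unfolding sparse_cubes_def
  by (rule exI[of _ "\<lambda>_. cube k m"]) (auto simp: disjoint_family_on_def)

section \<open>Averages, stopping cubes and their cores\<close>

context dyadic_mass
begin

definition avg :: "int \<Rightarrow> ('n \<Rightarrow> int) \<Rightarrow> real" where
  "avg k m = mass k m * 2 powr (real_of_int k * real CARD('n))"

lemma avg_nonneg [simp]: "0 \<le> avg k m"
  by (simp add: avg_def)

lemma mass_eq_avg: "mass k m = avg k m * 2 powr (- real_of_int k * real CARD('n))"
  by (simp add: avg_def powr_minus)

lemma avg_le_parent: "avg k m \<le> 2 ^ CARD('n) * avg (k - 1) (coarse 1 m)"
proof -
  have "cube k m \<subseteq> cube (k - 1) (coarse 1 m)"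
    using idx_coarse'[of "k - 1" _ 1] by (auto simp: mem_cube)
  then have "(\<integral>\<^sup>+x\<in>cube k m. w x \<partial>lebesgue) \<le> (\<integral>\<^sup>+x\<in>cube (k - 1) (coarse 1 m). w x \<partial>lebesgue)"
    by (intro nn_integral_mono mult_left_mono) (auto simp: indicator_def)
  then have "mass k m \<le> mass (k - 1) (coarse 1 m)"
    by (simp add: ennreal_mass)
  moreover have "2 powr (real_of_int k * real CARD('n))
      = 2 ^ CARD('n) * 2 powr (real_of_int (k - 1) * real CARD('n))"
    by (simp add: algebra_simps flip: powr_add powr_realpow)
  ultimately show ?thesis
    by (simp add: avg_def mult_left_mono mult_ac)
qed

definition level :: "int \<Rightarrow> real" where
  "level j = 2 powr (real_of_int j * (real CARD('n) + 1))"

text \<open>Levels grow by the factor \<open>2 ^ (n + 1)\<close>, so that the average over a maximal cube above a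
  level, which is at most \<open>2 ^ n\<close> times that of its parent, is at most half of the next level.\<close>
definition stop :: "(int \<times> ('n \<Rightarrow> int)) set" where
  "stop = {(k, m). \<exists>j. level j < avg k m \<and> (\<forall>l\<ge>1. avg (k - int l) (coarse l m) \<le> level j)}"

lemma level_Suc: "level (j + 1) = 2 * 2 ^ CARD('n) * level j"
  by (simp add: level_def algebra_simps powr_add powr_realpow)

lemma level_pos: "0 < level j"
  by (simp add: level_def)

lemma level_less_iff: "level i < level j \<longleftrightarrow> i < j"
  by (simp add: level_def)

lemma level_le_iff: "level i \<le> level j \<longleftrightarrow> i \<le> j"
  by (simp add: level_def)

text \<open>What remains of a cube after removing all strictly smaller stopping cubes; these are the
  disjoint sets witnessing sparseness.\<close>

definition core :: "int \<times> ('n \<Rightarrow> int) \<Rightarrow> (real^'n) set" where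
  "core = (\<lambda>(k, m). {x. idx k x = m \<and> (\<forall>l\<ge>1. (k + int l, idx (k + int l) x) \<notin> stop)})"

lemma core_sets: "core (k, m) \<in> sets lebesgue"
proof -
  have "Measurable.pred lebesgue (\<lambda>x. idx k x = m \<and> (\<forall>l\<ge>1. (k + int l, idx (k + int l) x) \<notin> stop))"
    by measurable
  then show ?thesis
    by (simp add: core_def pred_def)
qed

text \<open>Cubes of one scale are disjoint; at different scales, a point of the finer stopping cube
  is by definition excluded from the core of the coarser one.\<close>

lemma disjoint_core: "disjoint_family_on core stop"
proof -
  have "x \<notin> core (k, m)"
    if "x \<in> core (k', m')" "(k, m) \<noteq> (k', m')" "(k', m') \<in> stop" "k \<le> k'" for x k m k' m'
  proof
    assume x: "x \<in> core (k, m)"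
    have "k' \<noteq> k"
      using that x by (auto simp: core_def)
    then have "1 \<le> nat (k' - k)" "k + int (nat (k' - k)) = k'"
      using that by auto
    moreover have "(k', idx k' x) \<in> stop"
      using that by (auto simp: core_def)
    ultimately show False
      using x unfolding core_def by force
  qed
  then show ?thesis
    unfolding disjoint_family_on_def by (metis disjoint_iff linear surj_pair)
qed

text \<open>Weak (1,1) bound with constant 1 for the dyadic maximal function localised to a cube.
  Splitting by the first \<open>l\<close> at which the average exceeds \<open>t\<close> gives
  disjoint unions of cubes, each of volume at most its mass divided by \<open>t\<close>.\<close>

lemma weak_type:
  assumes t: "0 < t"
  shows "ennreal t * emeasure lebesgue {x \<in> cube k m. \<exists>l\<ge>1. t < avg (k + int l) (idx (k + int l) x)}
    \<le> ennreal (mass k m)"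
proof -
  define D where "D l = {x. 1 \<le> l \<and> idx k x = m \<and> t < avg (k + int l) (idx (k + int l) x) \<and>
     (\<forall>l'. 1 \<le> l' \<longrightarrow> l' < l \<longrightarrow> avg (k + int l') (idx (k + int l') x) \<le> t)}" for l
  have D_sets [measurable]: "D l \<in> sets lebesgue" for l
  proof -
    have "Measurable.pred lebesgue (\<lambda>x. 1 \<le> l \<and> idx k x = m \<and> t < avg (k + int l) (idx (k + int l) x) \<and>
       (\<forall>l'. 1 \<le> l' \<longrightarrow> l' < l \<longrightarrow> avg (k + int l') (idx (k + int l') x) \<le> t))"
      by (intro pred_intros_logic pred_intros_countable idx_pred_measurable)
    then have "{x \<in> space lebesgue. x \<in> D l} \<in> sets lebesgue"
      unfolding D_def pred_def mem_Collect_eq .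
    then show ?thesis
      by simp
  qed
  have D_disj: "l = l'" if "x \<in> D l" "x \<in> D l'" for x l l'
  proof (rule ccontr)
    assume "l \<noteq> l'"
    then consider "l < l'" | "l' < l" by linarith
    then show False
    proof cases
      case 1
      with that have "avg (k + int l) (idx (k + int l) x) \<le> t" "t < avg (k + int l) (idx (k + int l) x)"
        unfolding D_def by blast+
      then show False by linarith
    next
      case 2
      with that have "avg (k + int l') (idx (k + int l') x) \<le> t" "t < avg (k + int l') (idx (k + int l') x)"
        unfolding D_def by blast+
      then show False by linarith
    qed
  qed
  have D_cube: "x \<in> D l \<Longrightarrow> x \<in> cube k m" for x l
    by (simp add: D_def mem_cube)
  have D_ex: "\<exists>l. x \<in> D l" if "x \<in> cube k m" "\<exists>l\<ge>1. t < avg (k + int l) (idx (k + int l) x)" for x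
  proof -
    define l where "l = (LEAST l. l \<ge> 1 \<and> t < avg (k + int l) (idx (k + int l) x))"
    have "l \<ge> 1 \<and> t < avg (k + int l) (idx (k + int l) x)"
      unfolding l_def using that(2) by (rule LeastI_ex)
    moreover have "avg (k + int l') (idx (k + int l') x) \<le> t" if "1 \<le> l'" "l' < l" for l'
      using that not_less_Least[of l'] unfolding l_def by (metis not_less)
    ultimately show ?thesis
      using that(1) by (auto simp: D_def mem_cube)
  qed
  have D_mass: "ennreal t * emeasure lebesgue (D l) \<le> (\<integral>\<^sup>+x. indicator (D l) x * w x \<partial>lebesgue)" for l
  proof -
    \<comment> \<open>All conditions defining \<open>D l\<close> concern scales no finer than
      \<open>k + l\<close>, so they can be read off from the index \<open>M\<close> at that scale:
      \<open>D l\<close> is a union of cubes of scale \<open>k + l\<close>.\<close>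
    define P where "P M \<longleftrightarrow> 1 \<le> l \<and> coarse l M = m \<and> t < avg (k + int l) M \<and>
       (\<forall>l'. 1 \<le> l' \<longrightarrow> l' < l \<longrightarrow> avg (k + int l') (coarse (l - l') M) \<le> t)" for M
    have ce: "coarse (l - l') (idx (k + int l) x) = idx (k + int l') x" if "l' < l" for l' x
      using idx_coarse'[of "k + int l'" x "l - l'"] that by (simp add: of_nat_diff)
    have "(\<forall>l'. 1 \<le> l' \<longrightarrow> l' < l \<longrightarrow> avg (k + int l') (coarse (l - l') (idx (k + int l) x)) \<le> t)
        \<longleftrightarrow> (\<forall>l'. 1 \<le> l' \<longrightarrow> l' < l \<longrightarrow> avg (k + int l') (idx (k + int l') x) \<le> t)" for x
      by (intro iff_allI imp_cong refl) (simp only: ce)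
    then have "x \<in> D l \<longleftrightarrow> P (idx (k + int l) x)" for x
      unfolding D_def P_def mem_Collect_eq idx_coarse'[of k x l, symmetric] by (simp only:)
    then have D_P: "indicator (D l) x = (if P (idx (k + int l) x) then 1 else 0 :: ennreal)" for x
      by (simp add: indicator_def)
    have "ennreal t * emeasure lebesgue (D l) = (\<integral>\<^sup>+x. (if P (idx (k + int l) x) then ennreal t else 0) \<partial>lebesgue)"
    proof -
      have "ennreal t * emeasure lebesgue (D l) = (\<integral>\<^sup>+x. ennreal t * indicator (D l) x \<partial>lebesgue)"
        by (simp add: nn_integral_cmult_indicator)
      then show ?thesis
        by (simp add: D_P if_distrib cong: if_cong)
    qed
    also have "\<dots> = (\<integral>\<^sup>+M. ennreal (2 powr (- real_of_int (k + int l) * real CARD('n))) * (if P M then ennreal t else 0) \<partial>count_space UNIV)"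
      by (subst nn_integral_idx_1) (simp add: nn_integral_cmult)
    also have "\<dots> \<le> (\<integral>\<^sup>+M. (if P M then 1 else 0) * ennreal (mass (k + int l) M) \<partial>count_space UNIV)"
    proof (rule nn_integral_mono)
      fix M
      show "ennreal (2 powr (- real_of_int (k + int l) * real CARD('n))) * (if P M then ennreal t else 0)
          \<le> (if P M then 1 else 0) * ennreal (mass (k + int l) M)"
      proof (cases "P M")
        case True
        then have "t \<le> avg (k + int l) M" by (simp add: P_def)
        then have "2 powr (- real_of_int (k + int l) * real CARD('n)) * t \<le> mass (k + int l) M"
          by (subst mass_eq_avg) (simp add: mult.commute mult_left_mono)
        with True t show ?thesis
          by (simp add: ennreal_leI flip: ennreal_mult)
      qed simp
    qed
    also have "\<dots> = (\<integral>\<^sup>+x. indicator (D l) x * w x \<partial>lebesgue)"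
      unfolding D_P by (subst nn_integral_idx_mass) simp
    finally show ?thesis .
  qed
  have "{x \<in> cube k m. \<exists>l\<ge>1. t < avg (k + int l) (idx (k + int l) x)} \<subseteq> (\<Union>l. D l)"
    using D_ex by blast
  then have "emeasure lebesgue {x \<in> cube k m. \<exists>l\<ge>1. t < avg (k + int l) (idx (k + int l) x)}
      \<le> emeasure lebesgue (\<Union>l. D l)"
    by (rule emeasure_mono) auto
  also have "\<dots> \<le> (\<Sum>l. emeasure lebesgue (D l))"
    by (rule emeasure_subadditive_countably) auto
  also have "\<dots> = (\<integral>\<^sup>+l. emeasure lebesgue (D l) \<partial>count_space UNIV)"
    by (simp add: nn_integral_count_space_nat)
  finally have "ennreal t * emeasure lebesgue {x \<in> cube k m. \<exists>l\<ge>1. t < avg (k + int l) (idx (k + int l) x)}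
      \<le> ennreal t * (\<integral>\<^sup>+l. emeasure lebesgue (D l) \<partial>count_space UNIV)"
    by (rule mult_left_mono) simp
  also have "\<dots> = (\<integral>\<^sup>+l. ennreal t * emeasure lebesgue (D l) \<partial>count_space UNIV)"
    by (simp add: nn_integral_cmult)
  also have "\<dots> \<le> (\<integral>\<^sup>+l. \<integral>\<^sup>+x. indicator (D l) x * w x \<partial>lebesgue \<partial>count_space UNIV)"
    by (intro nn_integral_mono D_mass)
  also have "\<dots> = (\<integral>\<^sup>+x. \<integral>\<^sup>+l. indicator (D l) x * w x \<partial>count_space UNIV \<partial>lebesgue)"
    by (rule nn_integral_count_space_nn_integral[symmetric]) auto
  also have "\<dots> \<le> (\<integral>\<^sup>+x\<in>cube k m. w x \<partial>lebesgue)"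
  proof (rule nn_integral_mono)
    fix x
    show "(\<integral>\<^sup>+l. indicator (D l) x * w x \<partial>count_space UNIV) \<le> w x * indicator (cube k m) x"
    proof (cases "\<exists>l. x \<in> D l")
      case True
      then obtain l0 where l0: "x \<in> D l0" by blast
      have "(\<integral>\<^sup>+l. indicator (D l) x * w x \<partial>count_space UNIV)
          = (\<integral>\<^sup>+l. w x * indicator {l0} l \<partial>count_space UNIV)"
        using l0 D_disj by (intro nn_integral_cong) (auto simp: indicator_def)
      also have "\<dots> = w x"
        by (simp add: nn_integral_count_space_indicator[symmetric] nn_integral_count_space_finite)
      also have "\<dots> = w x * indicator (cube k m) x"
        by (simp add: D_cube[OF l0])
      finally show ?thesis
        by (rule eq_refl)
    qed simp
  qed
  finally show ?thesis
    unfolding ennreal_mass .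
qed

text \<open>The removed part lies in \<open>bad\<close>, where some smaller cube has average above
  the next level. The weak type bound and the parent's average limit \<open>bad\<close> to half of
  the cube.\<close>

lemma core_measure:
  assumes "(k, m) \<in> stop"
  shows "measure lebesgue (cube k m) / 2 \<le> measure lebesgue (core (k, m))"
proof -
  obtain j where j: "level j < avg k m" "\<And>l. 1 \<le> l \<Longrightarrow> avg (k - int l) (coarse l m) \<le> level j"
    using assms by (auto simp: stop_def)
  let ?t = "level (j + 1)" and ?s = "2 powr (- real_of_int k * real CARD('n))"
  define bad where "bad = {x \<in> cube k m. \<exists>l\<ge>1. ?t < avg (k + int l) (idx (k + int l) x)}"
  have bad_sets: "bad \<in> sets lebesgue"
  proof -
    have "Measurable.pred lebesgue (\<lambda>x. idx k x = m \<and> (\<exists>l\<ge>1. ?t < avg (k + int l) (idx (k + int l) x)))"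
      by measurable
    then have "{x \<in> space lebesgue. x \<in> bad} \<in> sets lebesgue"
      unfolding bad_def pred_def mem_Collect_eq mem_cube .
    then show ?thesis
      by simp
  qed
  have bad_cube: "bad \<subseteq> cube k m" and core_cube: "core (k, m) \<subseteq> cube k m"
    unfolding bad_def core_def cube_def by blast+
  have fin: "emeasure lebesgue bad < \<infinity>"
  proof (rule le_less_trans)
    show "emeasure lebesgue bad \<le> emeasure lebesgue (cube k m)"
      using bad_cube by (rule emeasure_mono) simp
  qed (simp add: emeasure_cube)
  have "ennreal ?t * emeasure lebesgue bad \<le> ennreal (mass k m)"
    unfolding bad_def by (rule weak_type) (rule level_pos)
  then have "?t * measure lebesgue bad \<le> mass k m"
    using fin level_pos[of "j + 1"]
    by (simp add: emeasure_eq_ennreal_measure less_top[symmetric] flip: ennreal_mult)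
  also have "\<dots> = avg k m * ?s"
    by (rule mass_eq_avg)
  also have "\<dots> \<le> (2 ^ CARD('n) * level j) * ?s"
    using avg_le_parent[of k m] j(2)[of 1]
    by (intro mult_right_mono) (auto intro: order_trans mult_left_mono)
  also have "\<dots> = ?t * (?s / 2)"
    by (simp add: level_Suc)
  finally have bad_le: "measure lebesgue bad \<le> ?s / 2"
    using level_pos[of "j + 1"] by simp
  have "cube k m - core (k, m) \<subseteq> bad"
  proof
    fix x assume x: "x \<in> cube k m - core (k, m)"
    then obtain l where l: "1 \<le> l" "(k + int l, idx (k + int l) x) \<in> stop"
      by (auto simp: core_def mem_cube)
    then obtain i where i: "level i < avg (k + int l) (idx (k + int l) x)"
      "avg (k + int l - int l) (coarse l (idx (k + int l) x)) \<le> level i"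
      unfolding stop_def by blast
    have "coarse l (idx (k + int l) x) = m"
      using x idx_coarse'[of k x l] by (simp add: mem_cube)
    \<comment> \<open>The cube itself is a strict ancestor of the smaller stopping cube, so its
      average is at most \<open>level i\<close>; being above \<open>level j\<close>, it forces
      \<open>i \<ge> j + 1\<close>.\<close>
    then have "level j < level i"
      using i(2) j(1) by simp
    then have "?t \<le> level i"
      by (simp add: level_less_iff level_le_iff)
    with i(1) l(1) x show "x \<in> bad"
      unfolding bad_def by (blast intro: le_less_trans)
  qed
  then have "measure lebesgue (cube k m) \<le> measure lebesgue (core (k, m) \<union> bad)"
  proof (intro measure_mono_fmeasurable)
    show "core (k, m) \<union> bad \<in> fmeasurable lebesgue"
    proof (rule fmeasurableI)
      show "emeasure lebesgue (core (k, m) \<union> bad) < \<infinity>"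
      proof (rule le_less_trans)
        show "emeasure lebesgue (core (k, m) \<union> bad) \<le> emeasure lebesgue (cube k m)"
          using bad_cube core_cube by (intro emeasure_mono) auto
      qed (simp add: emeasure_cube)
    qed (use bad_sets core_sets in auto)
  qed (use bad_cube core_cube in auto)
  also have "\<dots> \<le> measure lebesgue (core (k, m)) + measure lebesgue bad"
    by (rule measure_Un_le) (auto simp: core_sets bad_sets)
  finally show ?thesis
    using bad_le by (simp add: measure_cube)
qed

lemma sparse_stop: "sparse_cubes stop"
  unfolding sparse_cubes_def using core_sets core_measure disjoint_core
  by (intro exI[of _ core]) (auto simp: core_def mem_cube)

text \<open>With avg between consecutive levels \<open>j\<close> and \<open>j + 1\<close>, the
  coarsest ancestor whose average exceeds \<open>level j\<close> is a stopping cube; it exists by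
  the decay hypothesis and may be the cube itself. The constant is the ratio of consecutive
  levels.\<close>

lemma ex_stop_ancestor:
  assumes vanish: "\<And>t. 0 < t \<Longrightarrow> \<exists>L. \<forall>l\<ge>L. avg (k - int l) (coarse l m) \<le> t"
    and pos: "0 < avg k m"
  shows "\<exists>l. (k - int l, coarse l m) \<in> stop \<and> avg k m \<le> 2 * 2 ^ CARD('n) * avg (k - int l) (coarse l m)"
proof -
  \<comment> \<open>The ceiling minus one gives a strict lower inequality, which puts the cube
    itself, \<open>l = 0\<close>, into \<open>Z\<close>.\<close>
  define j where "j = \<lceil>log 2 (avg k m) / (real CARD('n) + 1)\<rceil> - 1"
  have "real_of_int j < log 2 (avg k m) / (real CARD('n) + 1)"
    "log 2 (avg k m) / (real CARD('n) + 1) \<le> real_of_int (j + 1)"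
    unfolding j_def by linarith+
  then have "real_of_int j * (real CARD('n) + 1) < log 2 (avg k m)"
    "log 2 (avg k m) \<le> real_of_int (j + 1) * (real CARD('n) + 1)"
    by (simp_all add: less_divide_eq divide_le_eq)
  then have j: "level j < avg k m" "avg k m \<le> level (j + 1)"
    using pos by (simp_all add: level_def powr_less_iff le_powr_iff)
  define Z where "Z = {l. level j < avg (k - int l) (coarse l m)}"
  obtain L where L: "\<And>l. l \<ge> L \<Longrightarrow> avg (k - int l) (coarse l m) \<le> level j"
    using vanish[OF level_pos[of j]] by blast
  then have "Z \<subseteq> {..<L}"
    unfolding Z_def by (auto simp: not_le[symmetric])
  then have fin: "finite Z" by (rule finite_subset) simp
  have "0 \<in> Z" using j by (simp add: Z_def)
  define l where "l = Max Z"
  have l: "l \<in> Z" "\<And>i. i > l \<Longrightarrow> i \<notin> Z"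
    unfolding l_def using fin \<open>0 \<in> Z\<close> Max_in[of Z] Max_ge[of Z] by (blast, meson not_le)
  have "avg (k - int l - int i) (coarse i (coarse l m)) \<le> level j" if "1 \<le> i" for i
    using l(2)[of "l + i"] that by (simp add: Z_def coarse_coarse not_less diff_diff_eq)
  then have "(k - int l, coarse l m) \<in> stop"
    unfolding stop_def using l(1) by (auto simp: Z_def)
  moreover have "avg k m \<le> 2 * 2 ^ CARD('n) * avg (k - int l) (coarse l m)"
  proof -
    have "level (j + 1) \<le> 2 * 2 ^ CARD('n) * avg (k - int l) (coarse l m)"
      unfolding level_Suc using l(1) by (intro mult_left_mono) (auto simp: Z_def)
    with j(2) show ?thesis by simp
  qed
  ultimately show ?thesis by blast
qed

text \<open>The average is 2^(in/p) times the q-th root of \<open>coef\<close>, so a uniform bound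
  on \<open>coef\<close> makes the bound on averages shrink by the factor 2^(-n/p) with each
  generation upwards.\<close>

lemma avg_vanish:
  assumes "0 < p" "0 < q" and bd: "\<And>k m. coef p q k m \<le> b" and t: "0 < t"
  shows "\<exists>L. \<forall>l\<ge>L. avg (k - int l) (coarse l m) \<le> t"
proof -
  have le: "avg i m' \<le> b powr (1 / q) * 2 powr (real_of_int i * (real CARD('n) / p))" for i m'
  proof -
    have "0 \<le> b" using bd[of i m'] coef_nonneg order_trans by blast
    have "2 powr (real_of_int i * (real CARD('n) * (1 - 1 / p))) * mass i m' = coef p q i m' powr (1 / q)"
      using assms by (simp add: coef_def powr_powr)
    also have "\<dots> \<le> b powr (1 / q)"
      using assms bd by (intro powr_mono2) auto
    finally have "2 powr (real_of_int i * (real CARD('n) / p)) * (2 powr (real_of_int i * (real CARD('n) * (1 - 1 / p))) * mass i m')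
        \<le> 2 powr (real_of_int i * (real CARD('n) / p)) * b powr (1 / q)"
      by (intro mult_left_mono) auto
    moreover have "real_of_int i * (real CARD('n) / p) + real_of_int i * (real CARD('n) * (1 - 1 / p))
        = real_of_int i * real CARD('n)"
      by (simp add: algebra_simps)
    then have "2 powr (real_of_int i * (real CARD('n) / p)) * (2 powr (real_of_int i * (real CARD('n) * (1 - 1 / p))) * mass i m')
       = avg i m'"
      unfolding avg_def mult.assoc[symmetric] powr_add[symmetric] by (simp add: mult.commute)
    ultimately show ?thesis by (simp only: mult.commute[of "b powr (1 / q)"])
  qed
  define r where "r = 2 powr (- (real CARD('n) / p))"
  have r: "0 < r" "r < 1"
    using assms powr_less_mono[of "- (real CARD('n) / p)" 0 2] by (auto simp: r_def)
  define c where "c = b powr (1 / q) * 2 powr (real_of_int k * (real CARD('n) / p))"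
  have "(\<lambda>l. c * r ^ l) \<longlonglongrightarrow> c * 0"
    using r by (intro tendsto_mult tendsto_const LIMSEQ_power_zero) auto
  then have "\<forall>\<^sub>F l in sequentially. c * r ^ l < t"
    using t by (intro order_tendstoD(2)[where y = "c * 0"]) auto
  then obtain L where L: "\<And>l. l \<ge> L \<Longrightarrow> c * r ^ l < t"
    by (auto simp: eventually_sequentially)
  have "avg (k - int l) (coarse l m) \<le> c * r ^ l" for l
  proof -
    have "2 powr (real_of_int (k - int l) * (real CARD('n) / p)) = 2 powr (real_of_int k * (real CARD('n) / p)) * r ^ l"
      by (simp add: r_def powr_powr algebra_simps diff_divide_distrib flip: powr_add powr_realpow)
    then show ?thesis
      using le[of "k - int l" "coarse l m"] by (simp add: c_def mult.assoc)
  qed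
  then show ?thesis
    using L by (meson less_imp_le order_trans)
qed

text \<open>That is |Q|^(q/p-1) avg^(q-1) mass. One factor of the mass is kept linear so that sums
  over cubes become integrals against \<open>w\<close>.\<close>

lemma coef_eq_avg:
  assumes "0 < p" "0 < q"
  shows "coef p q k m = 2 powr (- real_of_int k * (real CARD('n) * (q / p - 1))) * avg k m powr (q - 1) * mass k m"
proof (cases "mass k m = 0")
  case False
  then have pos: "0 < mass k m" using mass_nonneg[of k m] by linarith
  have "- real_of_int k * (real CARD('n) * (q / p - 1)) + real_of_int k * real CARD('n) * (q - 1)
      = real_of_int k * (real CARD('n) * (1 - 1 / p)) * q"
    using assms by (simp add: field_simps)
  then have *: "2 powr (- real_of_int k * (real CARD('n) * (q / p - 1))) * (2 powr (real_of_int k * real CARD('n))) powr (q - 1)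
      = (2 powr (real_of_int k * (real CARD('n) * (1 - 1 / p)))) powr q"
    unfolding powr_powr powr_add[symmetric] by (rule arg_cong)
  have "mass k m powr (q - 1) * mass k m = mass k m powr q"
    using pos by (simp add: powr_diff)
  then show ?thesis
    unfolding coef_def avg_def using pos by (simp add: powr_mult *[symmetric] mult_ac)
qed (simp add: coef_def)

text \<open>Before integration against \<open>w\<close>, the factor |Q|^(q/p-1) avg^(q-1) at a point
  is compared with that of a stopping ancestor l generations up: the average costs a constant, and
  the volume gains r^l with r < 1 because p < q. Summing over all \<open>l\<close> avoids recording
  which one occurs.\<close>

lemma energy_le_stop:
  assumes p: "0 < p" "p < q" "1 < q"
    and bd: "\<And>k m. coef p q k m \<le> b"
  shows "energy p q \<le> ennreal ((2 * 2 ^ CARD('n)) powr (q - 1) / (1 - 2 powr (- (real CARD('n) * (q / p - 1)))))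
    * (\<integral>\<^sup>+k. \<integral>\<^sup>+m. ennreal (coef p q k m) * indicator stop (k, m) \<partial>count_space UNIV \<partial>count_space UNIV)"
proof -
  define e where "e = real CARD('n) * (q / p - 1)"
  have e: "0 < e" using p by (simp add: e_def)
  define r where "r = 2 powr (- e)"
  have r: "0 < r" "r < 1"
    using e powr_less_mono[of "- e" 0 2] by (auto simp: r_def)
  define A where "A = (2 * 2 ^ CARD('n) :: real)"
  define u where "u k m = ennreal (2 powr (- real_of_int k * e) * avg k m powr (q - 1))" for k m
  have u_mass: "u k m * ennreal (mass k m) = ennreal (coef p q k m)" for k m
    using p unfolding u_def e_def by (subst coef_eq_avg) (auto simp flip: ennreal_mult)
  define g where "g k x = u k (idx k x) * indicator stop (k, idx k x) * w x" for k x
  have [measurable]: "g k \<in> borel_measurable lebesgue" for k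
    unfolding g_def by measurable
  have g_int: "(\<integral>\<^sup>+x. g k x \<partial>lebesgue) = (\<integral>\<^sup>+m. ennreal (coef p q k m) * indicator stop (k, m) \<partial>count_space UNIV)" for k
    unfolding g_def by (subst nn_integral_idx_mass[where h = "\<lambda>m. u k m * indicator stop (k, m)"])
      (simp add: u_mass[symmetric] mult_ac)
  define G where "G k l x = ennreal (A powr (q - 1)) * ennreal (r ^ l) * g (k - int l) x" for k l x
  have point: "u k (idx k x) * w x \<le> (\<integral>\<^sup>+l. G k l x \<partial>count_space UNIV)" for k x
  proof (cases "avg k (idx k x) = 0")
    case False
    then have "0 < avg k (idx k x)" using avg_nonneg[of k "idx k x"] by linarith
    then obtain l where l: "(k - int l, coarse l (idx k x)) \<in> stop"
      "avg k (idx k x) \<le> A * avg (k - int l) (coarse l (idx k x))"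
      unfolding A_def using ex_stop_ancestor[OF avg_vanish[OF _ _ bd]] p by (metis order_less_trans)
    have idx: "coarse l (idx k x) = idx (k - int l) x"
      using idx_coarse'[of "k - int l" x l] by simp
    have "avg k (idx k x) powr (q - 1) \<le> (A * avg (k - int l) (idx (k - int l) x)) powr (q - 1)"
      using l(2) p unfolding idx by (intro powr_mono2) auto
    then have "2 powr (- real_of_int k * e) * avg k (idx k x) powr (q - 1)
        \<le> 2 powr (- real_of_int k * e) * (A * avg (k - int l) (idx (k - int l) x)) powr (q - 1)"
      by (intro mult_left_mono) auto
    also have "\<dots> = r ^ l * 2 powr (- real_of_int (k - int l) * e) * (A * avg (k - int l) (idx (k - int l) x)) powr (q - 1)"
    proof -
      have "2 powr (- real_of_int k * e) = r ^ l * 2 powr (- real_of_int (k - int l) * e)"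
        by (simp add: r_def powr_powr algebra_simps flip: powr_add powr_realpow)
      then show ?thesis by (simp only:)
    qed
    finally have "u k (idx k x) \<le> ennreal (A powr (q - 1) * r ^ l * (2 powr (- real_of_int (k - int l) * e)
        * avg (k - int l) (idx (k - int l) x) powr (q - 1)))"
      unfolding u_def by (intro ennreal_leI) (simp add: powr_mult A_def mult_ac)
    also have "\<dots> = ennreal (A powr (q - 1)) * ennreal (r ^ l) * u (k - int l) (idx (k - int l) x)"
      using r unfolding u_def by (simp add: ennreal_mult)
    finally have "u k (idx k x) * w x \<le> G k l x"
      unfolding G_def g_def using l(1) idx by (simp add: mult_right_mono mult.assoc[symmetric])
    also have "\<dots> \<le> (\<integral>\<^sup>+l. G k l x \<partial>count_space UNIV)"
      by (rule nn_integral_ge_point) simp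
    finally show ?thesis .
  qed (simp add: u_def)
  have "energy p q = (\<integral>\<^sup>+k. \<integral>\<^sup>+x. u k (idx k x) * w x \<partial>lebesgue \<partial>count_space UNIV)"
    unfolding energy_def by (subst nn_integral_idx_mass) (simp add: u_mass)
  also have "\<dots> \<le> (\<integral>\<^sup>+k. \<integral>\<^sup>+x. \<integral>\<^sup>+l. G k l x \<partial>count_space UNIV \<partial>lebesgue \<partial>count_space UNIV)"
    by (intro nn_integral_mono point)
  also have "\<dots> = (\<integral>\<^sup>+k. \<integral>\<^sup>+l. \<integral>\<^sup>+x. G k l x \<partial>lebesgue \<partial>count_space UNIV \<partial>count_space UNIV)"
    unfolding G_def by (subst nn_integral_count_space_nn_integral) auto
  also have "\<dots> = (\<integral>\<^sup>+l. \<integral>\<^sup>+k. \<integral>\<^sup>+x. G k l x \<partial>lebesgue \<partial>count_space UNIV \<partial>count_space UNIV)"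
    by (rule nn_integral_count_space_nn_integral) auto
  also have "\<dots> = (\<integral>\<^sup>+l. ennreal (A powr (q - 1)) * ennreal (r ^ l) * (\<integral>\<^sup>+k. \<integral>\<^sup>+x. g k x \<partial>lebesgue \<partial>count_space UNIV) \<partial>count_space UNIV)"
  proof (rule nn_integral_cong)
    fix l
    \<comment> \<open>Scales range over all integers, so translation by \<open>l\<close> leaves the
      sum unchanged and only the factor r^l depends on \<open>l\<close>.\<close>
    have "bij_betw (\<lambda>k. k - int l) UNIV UNIV"
      by (rule bij_betwI[where g = "\<lambda>k. k + int l"]) auto
    then have "(\<integral>\<^sup>+k. \<integral>\<^sup>+x. g (k - int l) x \<partial>lebesgue \<partial>count_space UNIV) = (\<integral>\<^sup>+k. \<integral>\<^sup>+x. g k x \<partial>lebesgue \<partial>count_space UNIV)"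
      by (rule nn_integral_bij_count_space[where f = "\<lambda>k. \<integral>\<^sup>+x. g k x \<partial>lebesgue"])
    then show "(\<integral>\<^sup>+k. \<integral>\<^sup>+x. G k l x \<partial>lebesgue \<partial>count_space UNIV)
       = ennreal (A powr (q - 1)) * ennreal (r ^ l) * (\<integral>\<^sup>+k. \<integral>\<^sup>+x. g k x \<partial>lebesgue \<partial>count_space UNIV)"
      unfolding G_def by (simp add: nn_integral_cmult)
  qed
  also have "\<dots> = ennreal (A powr (q - 1)) * (\<integral>\<^sup>+l. ennreal (r ^ l) \<partial>count_space UNIV)
      * (\<integral>\<^sup>+k. \<integral>\<^sup>+x. g k x \<partial>lebesgue \<partial>count_space UNIV)"
    by (simp add: nn_integral_multc nn_integral_cmult)
  also have "(\<integral>\<^sup>+l. ennreal (r ^ l) \<partial>count_space UNIV) = ennreal (1 / (1 - r))"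
  proof -
    have "(\<Sum>l. ennreal (r ^ l)) = ennreal (\<Sum>l. r ^ l)"
      using r by (intro suminf_ennreal2 summable_geometric) auto
    then show ?thesis
      using r by (simp add: nn_integral_count_space_nat suminf_geometric)
  qed
  also have "ennreal (A powr (q - 1)) * ennreal (1 / (1 - r)) = ennreal (A powr (q - 1) / (1 - r))"
    using r by (simp flip: ennreal_mult)
  finally show ?thesis
    unfolding g_int A_def r_def e_def .
qed

end

section \<open>Comparison of the norms\<close>

lemma nn_integral_count_space_le_infsum:
  fixes f :: "nat \<Rightarrow> ennreal"
  shows "(\<integral>\<^sup>+i. f i \<partial>count_space I) \<le> infsum f I"
proof -
  have "(\<integral>\<^sup>+i. f i \<partial>count_space I) = (\<integral>\<^sup>+i. f i * indicator I i \<partial>count_space UNIV)"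
    by (cases "I = UNIV") (simp_all add: nn_integral_count_space_indicator)
  also have "\<dots> = (SUP n. \<Sum>i<n. f i * indicator I i)"
    by (simp add: nn_integral_count_space_nat suminf_eq_SUP)
  also have "\<dots> \<le> infsum f I"
  proof (rule SUP_least)
    fix n
    have "(\<Sum>i<n. f i * indicator I i) = (\<Sum>i\<in>{..<n} \<inter> I. f i)"
      by (simp add: indicator_def sum.If_cases if_distrib Int_def cong: if_cong)
    also have "\<dots> \<le> (SUP F\<in>{F. finite F \<and> F \<subseteq> I}. sum f F)"
      by (rule SUP_upper) auto
    also have "\<dots> = infsum f I"
      by (rule nonneg_infsum_complete[symmetric]) simp
    finally show "(\<Sum>i<n. f i * indicator I i) \<le> infsum f I" .
  qed
  finally show ?thesis .
qed

text \<open>The q-th power of the sparse norm. Estimates are made at this level, and the root is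
  taken once at the end.\<close>

definition SR_sum :: "real \<Rightarrow> real \<Rightarrow> (real^'n \<Rightarrow> real) \<Rightarrow> ennreal" where
  "SR_sum p q f = (SUP IQ \<in> {(I, Q). sparse_family I Q}.
        infsum (\<lambda>i. epowr (ennreal (measure lebesgue (snd IQ i) powr (- (1 - 1 / p)))
                         * (\<integral>\<^sup>+ x \<in> snd IQ i. ennreal \<bar>f x\<bar> \<partial>lebesgue)) q) (fst IQ))"

lemma SR_norm_eq: "SR_norm p q f = epowr (SR_sum p q f) (1 / q)"
  by (simp add: SR_norm_def SR_sum_def)

definition riesz_nn :: "real \<Rightarrow> (real^'n \<Rightarrow> real) \<Rightarrow> real^'n \<Rightarrow> ennreal" where
  "riesz_nn lam f x = (\<integral>\<^sup>+y. ennreal \<bar>f y\<bar> * ennreal (norm (x - y) powr (lam - real CARD('n))) \<partial>lebesgue)"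

lemma locally_integrable_measurable:
  "locally_integrable f \<Longrightarrow> f \<in> borel_measurable lebesgue"
  by (simp add: locally_integrable_def)

lemma kernel_measurable:
  "(\<lambda>y. norm (x - y :: real^'n) powr s) \<in> borel_measurable lebesgue"
proof -
  have "(\<lambda>y. norm (x - y) powr s) \<in> borel_measurable borel"
    by measurable
  then show ?thesis
    by (intro measurable_completion) simp
qed

lemma riesz_nn_finite:
  fixes f :: "real^'n \<Rightarrow> real"
  assumes f: "locally_integrable f" and fin: "riesz_nn lam f x < top"
  shows "integrable lebesgue (\<lambda>y. f y * norm (x - y) powr (lam - real CARD('n)))"
proof (rule integrableI_bounded)
  note [measurable] = locally_integrable_measurable[OF f] kernel_measurable
  show "(\<lambda>y. f y * norm (x - y) powr (lam - real CARD('n))) \<in> borel_measurable lebesgue"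
    by measurable
  show "(\<integral>\<^sup>+y. ennreal (norm (f y * norm (x - y) powr (lam - real CARD('n)))) \<partial>lebesgue) < \<infinity>"
    using fin by (simp add: riesz_nn_def abs_mult ennreal_mult)
qed

text \<open>A finite \<open>riesz_nn\<close> implies absolute convergence, so the value \<infinity>
  of \<open>riesz_abs\<close> can occur only where \<open>riesz_nn\<close> is infinite as
  well.\<close>

lemma riesz_abs_le_nn:
  fixes f :: "real^'n \<Rightarrow> real"
  assumes f: "locally_integrable f"
  shows "riesz_abs lam f x \<le> riesz_nn lam f x"
proof (cases "riesz_nn lam f x < top")
  case True
  note int = riesz_nn_finite[OF f True]
  have "ennreal \<bar>riesz_potential lam f x\<bar>
      \<le> (\<integral>\<^sup>+y. ennreal (norm (f y * norm (x - y) powr (lam - real CARD('n)))) \<partial>lebesgue)"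
    using integral_norm_bound_ennreal[OF int] by (simp add: riesz_potential_def)
  then show ?thesis
    using int by (simp add: riesz_abs_def riesz_nn_def abs_mult ennreal_mult)
qed (simp add: not_less top_unique)

lemma riesz_nn_le_abs:
  fixes f :: "real^'n \<Rightarrow> real"
  assumes nonneg: "AE y in lebesgue. 0 \<le> f y"
  shows "riesz_nn lam f x \<le> riesz_abs lam f x"
proof (cases "integrable lebesgue (\<lambda>y. f y * norm (x - y) powr (lam - real CARD('n)))")
  case True
  have ae: "AE y in lebesgue. 0 \<le> f y * norm (x - y) powr (lam - real CARD('n))"
    using nonneg by eventually_elim simp
  have "riesz_nn lam f x = (\<integral>\<^sup>+y. ennreal (f y * norm (x - y) powr (lam - real CARD('n))) \<partial>lebesgue)"
    unfolding riesz_nn_def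
    by (rule nn_integral_cong_AE) (use nonneg in \<open>eventually_elim, simp add: ennreal_mult\<close>)
  also have "\<dots> = ennreal (riesz_potential lam f x)"
    unfolding riesz_potential_def by (rule nn_integral_eq_integral[OF True ae])
  finally show ?thesis
    using True by (simp add: riesz_abs_def ennreal_leI)
qed (simp add: riesz_abs_def)

lemma dyadic_mass_abs:
  fixes f :: "real^'n \<Rightarrow> real"
  assumes f: "locally_integrable f"
  shows "dyadic_mass (\<lambda>x. ennreal \<bar>f x\<bar>)"
proof
  note [measurable] = locally_integrable_measurable[OF f]
  show "(\<lambda>x. ennreal \<bar>f x\<bar>) \<in> borel_measurable lebesgue"
    by measurable
  fix k and m :: "'n \<Rightarrow> int"
  obtain a b where ab: "cube k m \<subseteq> cbox a b"
    using cube_sandwich(2) by blast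
  have "set_integrable lebesgue (cbox a b) f"
    using f by (simp add: locally_integrable_def)
  then have "(\<integral>\<^sup>+x. ennreal (norm (indicator (cbox a b) x *\<^sub>R f x)) \<partial>lebesgue) < \<infinity>"
    unfolding set_integrable_def by (simp add: integrable_iff_bounded)
  moreover have "(\<integral>\<^sup>+x\<in>cube k m. ennreal \<bar>f x\<bar> \<partial>lebesgue)
      \<le> (\<integral>\<^sup>+x. ennreal (norm (indicator (cbox a b) x *\<^sub>R f x)) \<partial>lebesgue)"
    using ab by (intro nn_integral_mono) (auto simp: indicator_def)
  ultimately show "(\<integral>\<^sup>+x\<in>cube k m. ennreal \<bar>f x\<bar> \<partial>lebesgue) < top"
    by (simp add: le_less_trans)
qed

section \<open>Riesz potentials from below and the sparse-norm terms\<close>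

context dyadic_mass
begin

text \<open>Two points of the cube are at distance at most n times the side, by comparison with the
  l1 norm, so the kernel is bounded below there. This is the origin of the constant
  n^(n-lam).\<close>

lemma riesz_ge_cube:
  assumes lam: "lam \<le> real CARD('n)" and x: "x \<in> cube k m"
  shows "ennreal (2 powr (real_of_int k * (real CARD('n) - lam)) * mass k m)
    \<le> ennreal (real CARD('n) powr (real CARD('n) - lam))
      * (\<integral>\<^sup>+y. w y * ennreal (norm (x - y) powr (lam - real CARD('n))) \<partial>lebesgue)"
proof -
  define d where "d = real CARD('n) - lam"
  have d: "0 \<le> d" using lam by (simp add: d_def)
  let ?N = "real CARD('n)"
  have diam: "norm (x - y) \<le> ?N * 2 powr (- real_of_int k)" if "y \<in> cube k m" for y
  proof -
    have "\<bar>(x - y) $ i\<bar> \<le> 2 powr (- real_of_int k)" for i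
    proof -
      have "2 powr (- real_of_int k) * real_of_int (m i) \<le> x $ i \<and> x $ i < 2 powr (- real_of_int k) * (real_of_int (m i) + 1)"
        "2 powr (- real_of_int k) * real_of_int (m i) \<le> y $ i \<and> y $ i < 2 powr (- real_of_int k) * (real_of_int (m i) + 1)"
        using x that unfolding cube_eq by blast+
      then show ?thesis
        unfolding vector_minus_component distrib_left by linarith
    qed
    then have "(\<Sum>i\<in>UNIV. \<bar>(x - y) $ i\<bar>) \<le> ?N * 2 powr (- real_of_int k)"
      by (rule sum_bounded_above)
    then show ?thesis
      using norm_le_l1_cart[of "x - y"] by linarith
  qed
  have kernel: "2 powr (real_of_int k * d) \<le> ?N powr d * norm (x - y) powr (- d)"
    if "y \<in> cube k m" "y \<noteq> x" for y
  proof -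
    have "(?N * 2 powr (- real_of_int k)) powr (- d) \<le> norm (x - y) powr (- d)"
      using diam[OF that(1)] that(2) d by (intro powr_mono2') auto
    then have "?N powr d * (?N * 2 powr (- real_of_int k)) powr (- d) \<le> ?N powr d * norm (x - y) powr (- d)"
      by (rule mult_left_mono) simp
    moreover have "?N powr d * (?N * 2 powr (- real_of_int k)) powr (- d) = 2 powr (real_of_int k * d)"
    proof -
      have "(?N * 2 powr (- real_of_int k)) powr (- d) = ?N powr (- d) * 2 powr (real_of_int k * d)"
        by (subst powr_mult) (simp_all add: powr_powr)
      moreover have "?N powr d * ?N powr (- d) = 1"
        by (simp flip: powr_add)
      ultimately show ?thesis
        by (simp only: mult.assoc[symmetric] mult_1_left)
    qed
    ultimately show ?thesis by simp
  qed
  have meas: "(\<lambda>y. norm (x - y) powr (lam - real CARD('n))) \<in> borel_measurable lebesgue"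
    by (rule kernel_measurable)
  have "ennreal (2 powr (real_of_int k * d) * mass k m)
      = (\<integral>\<^sup>+y. ennreal (2 powr (real_of_int k * d)) * (w y * indicator (cube k m) y) \<partial>lebesgue)"
    by (simp add: nn_integral_cmult ennreal_mass ennreal_mult)
  also have "\<dots> \<le> (\<integral>\<^sup>+y. ennreal (?N powr d) * (w y * ennreal (norm (x - y) powr (lam - ?N))) \<partial>lebesgue)"
  \<comment> \<open>At \<open>y = x\<close> the kernel takes the value 0 instead of \<infinity> when
    \<open>d > 0\<close>, so the pointwise bound can fail there; the point is a null set.\<close>
  proof (rule nn_integral_mono_AE)
    have "AE y in lebesgue. y \<noteq> x"
      by (rule AE_completion) (rule AE_lborel_singleton)
    then show "AE y in lebesgue. ennreal (2 powr (real_of_int k * d)) * (w y * indicator (cube k m) y)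
        \<le> ennreal (?N powr d) * (w y * ennreal (norm (x - y) powr (lam - ?N)))"
    proof eventually_elim
      fix y assume "y \<noteq> x"
      show "ennreal (2 powr (real_of_int k * d)) * (w y * indicator (cube k m) y)
        \<le> ennreal (?N powr d) * (w y * ennreal (norm (x - y) powr (lam - ?N)))"
      proof (cases "y \<in> cube k m")
        case True
        have "ennreal (2 powr (real_of_int k * d)) \<le> ennreal (?N powr d) * ennreal (norm (x - y) powr (lam - ?N))"
          using kernel[OF True \<open>y \<noteq> x\<close>] by (simp add: d_def ennreal_leI flip: ennreal_mult)
        then have "ennreal (2 powr (real_of_int k * d)) * w y
            \<le> ennreal (?N powr d) * ennreal (norm (x - y) powr (lam - ?N)) * w y"
          by (rule mult_right_mono) simp
        with True show ?thesis by (simp add: mult_ac)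
      qed simp
    qed
  qed
  also have "\<dots> = ennreal (?N powr d) * (\<integral>\<^sup>+y. w y * ennreal (norm (x - y) powr (lam - ?N)) \<partial>lebesgue)"
    by (intro nn_integral_cmult borel_measurable_times_ennreal w_measurable measurable_compose[OF meas measurable_ennreal])
  finally show ?thesis
    by (simp add: d_def)
qed

lemma epowr_cube_term:
  "epowr (ennreal (measure lebesgue (cube k m) powr (- (1 - 1 / p)))
      * (\<integral>\<^sup>+x\<in>cube k m. w x \<partial>lebesgue)) q = ennreal (coef p q k m)"
proof -
  have "measure lebesgue (cube k m) powr (- (1 - 1 / p)) = 2 powr (real_of_int k * (real CARD('n) * (1 - 1 / p)))"
    unfolding measure_cube powr_powr by (simp add: algebra_simps)
  then show ?thesis
    by (simp add: ennreal_mass coef_def flip: ennreal_mult)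
qed

lemma coef_cube_density:
  assumes "0 < q" and lam: "lam = real CARD('n) * (1 / p - 1 / q)"
  shows "coef p q k m = measure lebesgue (cube k m)
    * (2 powr (real_of_int k * (real CARD('n) - lam)) * mass k m) powr q"
proof -
  have "real_of_int k * (real CARD('n) * (1 - 1 / p)) * q
      = - real_of_int k * real CARD('n) + real_of_int k * (real CARD('n) - lam) * q"
    using assms(1) unfolding lam by (simp add: field_simps)
  then have "(2 powr (real_of_int k * (real CARD('n) * (1 - 1 / p)))) powr q
      = 2 powr (- real_of_int k * real CARD('n)) * (2 powr (real_of_int k * (real CARD('n) - lam))) powr q"
    unfolding powr_powr by (simp only: powr_add)
  then show ?thesis
    by (simp add: coef_def measure_cube powr_mult)
qed

end

text \<open>Cube indices (k, m) form a countable type, so \<open>to_nat\<close> transports a sparse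
  set of them to a sparse family indexed by natural numbers.\<close>

lemma SR_sum_ge_sparse:
  fixes f :: "real^'n \<Rightarrow> real" and S :: "(int \<times> ('n \<Rightarrow> int)) set"
  assumes f: "locally_integrable f" and S: "sparse_cubes S"
  shows "(\<integral>\<^sup>+k. \<integral>\<^sup>+m. ennreal (dyadic_mass.coef (\<lambda>x. ennreal \<bar>f x\<bar>) p q k m) * indicator S (k, m)
      \<partial>count_space UNIV \<partial>count_space UNIV) \<le> SR_sum p q f"
proof -
  interpret dyadic_mass "\<lambda>x. ennreal \<bar>f x\<bar>"
    using f by (rule dyadic_mass_abs)
  define I where "I = to_nat ` S"
  define Q where "Q = (\<lambda>i. case from_nat i of (k, m :: 'n \<Rightarrow> int) \<Rightarrow> cube k m)"
  have from_I: "from_nat i \<in> S" if "i \<in> I" for i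
    using that by (auto simp: I_def)
  obtain E where E: "\<And>k m. (k, m) \<in> S \<Longrightarrow> E (k, m) \<in> sets lebesgue \<and> E (k, m) \<subseteq> cube k m \<and>
      measure lebesgue (E (k, m)) \<ge> measure lebesgue (cube k m) / 2" "disjoint_family_on E S"
    using S unfolding sparse_cubes_def by blast
  have "sparse_family I Q"
    unfolding sparse_family_def
  proof (intro conjI ballI exI[of _ "\<lambda>i. E (from_nat i)"])
    fix i assume "i \<in> I"
    obtain k :: int and m :: "'n \<Rightarrow> int" where km: "from_nat i = (k, m)" by fastforce
    then have "(k, m) \<in> S" using from_I[OF \<open>i \<in> I\<close>] by simp
    from E(1)[OF this] show "E (from_nat i) \<in> sets lebesgue" "E (from_nat i) \<subseteq> Q i"
      "measure lebesgue (Q i) / 2 \<le> measure lebesgue (E (from_nat i))"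
      by (auto simp: km Q_def)
    show "Q i \<in> dyadic_cubes"
      unfolding dyadic_cubes_eq by (auto simp: km Q_def)
  next
    show "disjoint_family_on (\<lambda>i. E (from_nat i)) I"
      using E(2) unfolding disjoint_family_on_def I_def by fastforce
  qed
  have bij: "bij_betw to_nat S I"
    unfolding I_def by (intro inj_on_imp_bij_betw inj_on_subset[OF inj_to_nat]) simp
  let ?T = "\<lambda>i. epowr (ennreal (measure lebesgue (Q i) powr (- (1 - 1 / p)))
      * (\<integral>\<^sup>+x\<in>Q i. ennreal \<bar>f x\<bar> \<partial>lebesgue)) q"
  have "(\<integral>\<^sup>+k. \<integral>\<^sup>+m. ennreal (coef p q k m) * indicator S (k, m) \<partial>count_space UNIV \<partial>count_space UNIV)
      = (\<integral>\<^sup>+c. (case c of (k, m) \<Rightarrow> ennreal (coef p q k m)) * indicator S c \<partial>count_space UNIV)"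
    by (subst nn_integral_fst_count_space[symmetric]) simp
  also have "\<dots> = (\<integral>\<^sup>+c. (case c of (k, m) \<Rightarrow> ennreal (coef p q k m)) \<partial>count_space S)"
    by (cases "S = UNIV") (simp_all add: nn_integral_count_space_indicator)
  also have "\<dots> = (\<integral>\<^sup>+c. ?T (to_nat c) \<partial>count_space S)"
  proof (rule nn_integral_cong)
    fix c :: "int \<times> ('n \<Rightarrow> int)"
    obtain k m where c: "c = (k, m)" by (cases c)
    show "(case c of (k, m) \<Rightarrow> ennreal (coef p q k m)) = ?T (to_nat c)"
      unfolding c Q_def from_nat_to_nat prod.case epowr_cube_term ..
  qed
  also have "\<dots> = (\<integral>\<^sup>+i. ?T i \<partial>count_space I)"
    by (rule nn_integral_bij_count_space[OF bij])
  also have "\<dots> \<le> infsum ?T I"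
    by (rule nn_integral_count_space_le_infsum)
  also have "\<dots> \<le> SR_sum p q f"
    unfolding SR_sum_def using \<open>sparse_family I Q\<close> by (intro SUP_upper2[of "(I, Q)"]) auto
  finally show ?thesis .
qed

text \<open>The factor 2 is |Q| \<le> 2 |E|, and the power is the constant of
  \<open>riesz_ge_cube\<close>. A general majorant \<open>R\<close> allows \<open>riesz_abs\<close>
  to be inserted directly.\<close>

lemma SR_sum_le_riesz:
  fixes f :: "real^'n \<Rightarrow> real"
  assumes f: "locally_integrable f" and q: "0 < q" and lam: "lam = real CARD('n) * (1 / p - 1 / q)"
    and lamn: "lam \<le> real CARD('n)"
    and R: "\<And>x. riesz_nn lam f x \<le> R x"
  shows "SR_sum p q f \<le> ennreal (2 * (real CARD('n) powr (real CARD('n) - lam)) powr q)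
    * (\<integral>\<^sup>+x. epowr (R x) q \<partial>lebesgue)"
proof -
  interpret dyadic_mass "\<lambda>x. ennreal \<bar>f x\<bar>"
    using f by (rule dyadic_mass_abs)
  define D where "D = real CARD('n) powr (real CARD('n) - lam)"
  have D: "0 < D" by (simp add: D_def)
  let ?T = "\<lambda>Q. epowr (ennreal (measure lebesgue Q powr (- (1 - 1 / p)))
      * (\<integral>\<^sup>+x\<in>Q. ennreal \<bar>f x\<bar> \<partial>lebesgue)) q"
  let ?J = "\<integral>\<^sup>+x. epowr (R x) q \<partial>lebesgue"
  have "infsum (\<lambda>i. ?T (Q i)) I \<le> ennreal (2 * D powr q) * ?J" if sp: "sparse_family I Q" for I Q
  proof -
    obtain E where E: "\<And>i. i \<in> I \<Longrightarrow> E i \<in> sets lebesgue" "\<And>i. i \<in> I \<Longrightarrow> E i \<subseteq> Q i"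
      "\<And>i. i \<in> I \<Longrightarrow> measure lebesgue (Q i) / 2 \<le> measure lebesgue (E i)" "disjoint_family_on E I"
      using sp unfolding sparse_family_def by blast
    have "\<forall>i\<in>I. \<exists>k m. Q i = cube k m"
      using sp unfolding sparse_family_def dyadic_cubes_eq by blast
    then obtain k m where Q: "\<And>i. i \<in> I \<Longrightarrow> Q i = cube (k i) (m i)"
      by metis
    define c where "c i = (1 / D * (2 powr (real_of_int (k i) * (real CARD('n) - lam)) * mass (k i) (m i))) powr q" for i
    have cube_term: "?T (Q i) \<le> ennreal (2 * D powr q) * (\<integral>\<^sup>+x. ennreal (c i) * indicator (E i) x \<partial>lebesgue)"
      if "i \<in> I" for i
    proof -
      have "emeasure lebesgue (E i) \<le> emeasure lebesgue (cube (k i) (m i))"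
        using E(2)[OF that] Q[OF that] by (intro emeasure_mono) auto
      then have fin: "emeasure lebesgue (E i) = ennreal (measure lebesgue (E i))"
        by (intro emeasure_eq_ennreal_measure) (auto simp: emeasure_cube top_unique)
      have "(2 powr (real_of_int (k i) * (real CARD('n) - lam)) * mass (k i) (m i)) powr q = D powr q * c i"
        using D unfolding c_def by (subst powr_mult[symmetric]) auto
      then have "?T (Q i) = ennreal (measure lebesgue (Q i) * (D powr q * c i))"
        unfolding Q[OF that] epowr_cube_term coef_cube_density[OF q lam] by simp
      also have "\<dots> \<le> ennreal (2 * measure lebesgue (E i) * (D powr q * c i))"
        using E(3)[OF that] by (intro ennreal_leI mult_right_mono) (auto simp: c_def)
      also have "\<dots> = ennreal (2 * D powr q * (c i * measure lebesgue (E i)))"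
        by (simp add: mult_ac)
      also have "\<dots> = ennreal (2 * D powr q) * (ennreal (c i) * emeasure lebesgue (E i))"
        unfolding fin by (subst ennreal_mult) (auto simp: c_def ennreal_mult)
      also have "\<dots> = ennreal (2 * D powr q) * (\<integral>\<^sup>+x. ennreal (c i) * indicator (E i) x \<partial>lebesgue)"
        using E(1)[OF that] by (simp add: nn_integral_cmult_indicator)
      finally show ?thesis .
    qed
    have point: "ennreal (c i) \<le> epowr (R x) q" if "i \<in> I" "x \<in> E i" for i x
    proof -
      let ?b = "2 powr (real_of_int (k i) * (real CARD('n) - lam)) * mass (k i) (m i)"
      have "x \<in> cube (k i) (m i)"
        using that E(2) Q by blast
      then have "ennreal ?b \<le> ennreal D * riesz_nn lam f x"
        unfolding D_def riesz_nn_def by (rule riesz_ge_cube[OF lamn])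
      then have "ennreal (1 / D) * ennreal ?b \<le> ennreal (1 / D) * (ennreal D * riesz_nn lam f x)"
        by (rule mult_left_mono) simp
      also have "\<dots> = riesz_nn lam f x"
        using D unfolding mult.assoc[symmetric] by (subst ennreal_mult[symmetric]) auto
      also have "\<dots> \<le> R x"
        by (rule R)
      finally have "ennreal (1 / D * ?b) \<le> R x"
        using D by (subst ennreal_mult) auto
      then have "epowr (ennreal (1 / D * ?b)) q \<le> epowr (R x) q"
        using q by (intro epowr_mono) auto
      then show ?thesis
        using D by (simp add: c_def)
    qed
    \<comment> \<open>\<open>infsum\<close> of extended nonnegative terms is the supremum of finite
      partial sums. In each of these, disjointness leaves at most one nonzero indicator at any
      point.\<close>
    have "(\<Sum>i\<in>F. ?T (Q i)) \<le> ennreal (2 * D powr q) * ?J" if F: "finite F" "F \<subseteq> I" for F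
    proof -
      have "(\<Sum>i\<in>F. ?T (Q i))
          \<le> (\<Sum>i\<in>F. ennreal (2 * D powr q) * (\<integral>\<^sup>+x. ennreal (c i) * indicator (E i) x \<partial>lebesgue))"
        using F by (intro sum_mono cube_term) auto
      also have "\<dots> = ennreal (2 * D powr q) * (\<integral>\<^sup>+x. (\<Sum>i\<in>F. ennreal (c i) * indicator (E i) x) \<partial>lebesgue)"
        using F E(1) by (subst nn_integral_sum) (auto simp: sum_distrib_left)
      also have "\<dots> \<le> ennreal (2 * D powr q) * ?J"
      proof (intro mult_left_mono nn_integral_mono)
        fix x
        show "(\<Sum>i\<in>F. ennreal (c i) * indicator (E i) x) \<le> epowr (R x) q"
        proof (cases "\<exists>i\<in>F. x \<in> E i")
          case True
          then obtain i where i: "i \<in> F" "x \<in> E i" by blast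
          have "x \<notin> E j" if "j \<in> F - {i}" for j
            using E(4) i that F(2) unfolding disjoint_family_on_def by blast
          then have rest: "(\<Sum>j\<in>F - {i}. ennreal (c j) * indicator (E j) x) = 0"
            by (intro sum.neutral) auto
          have "(\<Sum>j\<in>F. ennreal (c j) * indicator (E j) x) = ennreal (c i)"
            unfolding sum.remove[OF F(1) i(1)] rest using i by simp
          then show ?thesis
            using point[of i x] i F(2) by auto
        next
          case False
          then have "(\<Sum>i\<in>F. ennreal (c i) * indicator (E i) x) = 0"
            by (intro sum.neutral) auto
          then show ?thesis by simp
        qed
      qed simp
      finally show ?thesis .
    qed
    then show ?thesis
      by (subst nonneg_infsum_complete) (auto intro!: SUP_least)
  qed
  then show ?thesis
    unfolding SR_sum_def D_def by (auto intro!: SUP_least)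
qed

lemma levels_le_SR_sum:
  assumes p: "1 \<le> p" "p < q" and lam: "lam = real CARD('n) * (1 / p - 1 / q)"
  shows "\<exists>K>0. \<forall>f :: real^'n \<Rightarrow> real. locally_integrable f \<longrightarrow>
    (\<integral>\<^sup>+x. epowr (\<integral>\<^sup>+k. ennreal (dyadic_mass.riesz_level (\<lambda>x. ennreal \<bar>f x\<bar>) lam k x) \<partial>count_space UNIV) q \<partial>lebesgue)
      \<le> ennreal K * SR_sum p q f"
proof -
  have pq: "0 < p" "1 < q" "0 < q" "1 / q < 1 / p"
    using p by (auto simp: frac_less2)
  have lam0: "0 < lam"
    using pq by (simp add: lam)
  define K1 where "K1 = (2 * (q * (real (card (nbhd :: ('n \<Rightarrow> int) set)) / (1 - 2 powr (- lam))))) powr q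
        * real (card (nbhd :: ('n \<Rightarrow> int) set)) powr (q + 1)"
  define K2 where "K2 = (2 * 2 ^ CARD('n)) powr (q - 1) / (1 - 2 powr (- (real CARD('n) * (q / p - 1))))"
  have "2 powr (- lam) < 1"
    using lam0 powr_less_mono[of "- lam" 0 2] by simp
  then have K1: "0 < K1"
    using pq card_nbhd_pos[where 'n='n] unfolding K1_def by (intro mult_pos_pos) auto
  have "0 < real CARD('n) * (q / p - 1)"
    using p by simp
  then have "2 powr (- (real CARD('n) * (q / p - 1))) < 1"
    using powr_less_mono[of "- (real CARD('n) * (q / p - 1))" 0 2] by simp
  then have K2: "0 < K2"
    by (simp add: K2_def)
  have "(\<integral>\<^sup>+x. epowr (\<integral>\<^sup>+k. ennreal (dyadic_mass.riesz_level (\<lambda>x. ennreal \<bar>f x\<bar>) lam k x) \<partial>count_space UNIV) q \<partial>lebesgue)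
      \<le> ennreal (K1 * K2) * SR_sum p q f" if f: "locally_integrable f" for f :: "real^'n \<Rightarrow> real"
  proof (cases "SR_sum p q f")
    case top
    then show ?thesis
      using K1 K2 by (simp add: ennreal_mult_top)
  next
    case (real b)
    interpret dyadic_mass "\<lambda>x. ennreal \<bar>f x\<bar>"
      using f by (rule dyadic_mass_abs)
    \<comment> \<open>Single cubes are sparse, so the finite sparse norm bounds every term; stopping
      ancestors exist thanks to this bound.\<close>
    have bd: "coef p q k m \<le> b" for k m
    proof -
      have "ennreal (coef p q k m) = ennreal (coef p q k m) * indicator {(k, m)} (k, m)"
        by simp
      also have "\<dots> \<le> (\<integral>\<^sup>+m'. ennreal (coef p q k m') * indicator {(k, m)} (k, m') \<partial>count_space UNIV)"
        by (rule nn_integral_ge_point) simp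
      also have "\<dots> \<le> (\<integral>\<^sup>+k'. \<integral>\<^sup>+m'. ennreal (coef p q k' m') * indicator {(k, m)} (k', m') \<partial>count_space UNIV \<partial>count_space UNIV)"
        by (rule nn_integral_ge_point) simp
      also have "\<dots> \<le> SR_sum p q f"
        by (rule SR_sum_ge_sparse[OF f sparse_cubes_singleton])
      finally show ?thesis
        using real by simp
    qed
    have "(\<integral>\<^sup>+x. epowr (\<integral>\<^sup>+k. ennreal (riesz_level lam k x) \<partial>count_space UNIV) q \<partial>lebesgue)
        \<le> ennreal K1 * energy p q"
      unfolding K1_def by (rule riesz_levels_energy[OF pq(2,4) lam])
    also have "\<dots> \<le> ennreal K1 * (ennreal K2 * SR_sum p q f)"
    proof (intro mult_left_mono)
      have "energy p q \<le> ennreal K2 *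
          (\<integral>\<^sup>+k. \<integral>\<^sup>+m. ennreal (coef p q k m) * indicator stop (k, m) \<partial>count_space UNIV \<partial>count_space UNIV)"
        unfolding K2_def by (rule energy_le_stop[OF pq(1) p(2) pq(2) bd])
      also have "\<dots> \<le> ennreal K2 * SR_sum p q f"
        by (intro mult_left_mono SR_sum_ge_sparse[OF f sparse_stop]) simp
      finally show "energy p q \<le> ennreal K2 * SR_sum p q f" .
    qed simp
    finally show ?thesis
      using K1 K2 by (simp add: ennreal_mult mult.assoc)
  qed
  moreover have "0 < K1 * K2"
    using K1 K2 by simp
  ultimately show ?thesis
    by blast
qed

text \<open>Almost everywhere absolute convergence is a by-product: the sum of the levels of |f| has
  finite L^q norm, hence is finite almost everywhere, and it dominates the potential of |f|.\<close>

lemma riesz_le_SR: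
  assumes p: "1 \<le> p" "p < q" and lam: "lam = real CARD('n) * (1 / p - 1 / q)"
  shows "\<exists>C>0. \<forall>f :: real^'n \<Rightarrow> real. locally_integrable f \<longrightarrow>
    (SR_norm p q f < \<infinity> \<longrightarrow> (AE x in lebesgue. integrable lebesgue (\<lambda>y. f y * norm (x - y) powr (lam - real CARD('n))))) \<and>
    H_norm q lam f \<le> ennreal C * SR_norm p q f"
proof -
  have q: "0 < q" using p by simp
  have lamn: "lam < real CARD('n)"
  proof -
    have "1 / p \<le> 1" "0 < 1 / q" using p by auto
    then have "1 / p - 1 / q < 1" by linarith
    then show ?thesis by (simp add: lam)
  qed
  define c where "c = 2 powr (real CARD('n) - lam)"
  have c: "0 < c" by (simp add: c_def)
  obtain K where K: "K > 0" "\<And>f :: real^'n \<Rightarrow> real. locally_integrable f \<Longrightarrow>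
    (\<integral>\<^sup>+x. epowr (\<integral>\<^sup>+k. ennreal (dyadic_mass.riesz_level (\<lambda>x. ennreal \<bar>f x\<bar>) lam k x) \<partial>count_space UNIV) q \<partial>lebesgue)
      \<le> ennreal K * SR_sum p q f"
    using levels_le_SR_sum[OF p lam] by blast
  show ?thesis
  proof (intro exI[of _ "(c powr q * K) powr (1 / q)"] conjI allI impI)
    show "0 < (c powr q * K) powr (1 / q)"
      using c K by simp
  next
    fix f :: "real^'n \<Rightarrow> real"
    assume f: "locally_integrable f"
    interpret dyadic_mass "\<lambda>x. ennreal \<bar>f x\<bar>"
      using f by (rule dyadic_mass_abs)
    let ?L = "\<lambda>x. \<integral>\<^sup>+k. ennreal (riesz_level lam k x) \<partial>count_space UNIV"
    have L_meas [measurable]: "?L \<in> borel_measurable lebesgue"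
      by (simp add: nn_integral_count_space_int_SUP) measurable
    have le: "riesz_nn lam f x \<le> ennreal c * ?L x" for x
      unfolding riesz_nn_def c_def by (rule riesz_le_levels[OF lamn])
    show "AE x in lebesgue. integrable lebesgue (\<lambda>y. f y * norm (x - y) powr (lam - real CARD('n)))"
      if "SR_norm p q f < \<infinity>"
    proof -
      have "SR_sum p q f \<noteq> top"
        using that by (auto simp: SR_norm_eq)
      then have "(\<integral>\<^sup>+x. epowr (?L x) q \<partial>lebesgue) \<noteq> \<infinity>"
        using K(2)[OF f] by (auto simp: top_unique ennreal_mult_eq_top_iff)
      then have "AE x in lebesgue. epowr (?L x) q \<noteq> \<infinity>"
        by (intro nn_integral_PInf_AE) auto
      then show ?thesis
      proof eventually_elim
        case (elim x)
        then have "?L x \<noteq> top" by auto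
        then have "ennreal c * ?L x < top"
          by (simp add: ennreal_mult_less_top less_top)
        then show ?case
          using le[of x] by (intro riesz_nn_finite[OF f]) (rule le_less_trans)
      qed
    qed
    have "(\<integral>\<^sup>+x. epowr (riesz_abs lam f x) q \<partial>lebesgue) \<le> (\<integral>\<^sup>+x. epowr (ennreal c * ?L x) q \<partial>lebesgue)"
      using q le riesz_abs_le_nn[OF f] by (intro nn_integral_mono epowr_mono) (auto intro: order_trans)
    also have "\<dots> = ennreal (c powr q) * (\<integral>\<^sup>+x. epowr (?L x) q \<partial>lebesgue)"
      using c by (simp add: epowr_mult nn_integral_cmult)
    also have "\<dots> \<le> ennreal (c powr q) * (ennreal K * SR_sum p q f)"
      by (intro mult_left_mono K(2)[OF f]) simp
    also have "\<dots> = ennreal (c powr q * K) * SR_sum p q f"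
      using K by (simp add: ennreal_mult mult.assoc)
    finally have "H_norm q lam f \<le> epowr (ennreal (c powr q * K) * SR_sum p q f) (1 / q)"
      unfolding H_norm_def using q by (intro epowr_mono) auto
    then show "H_norm q lam f \<le> ennreal ((c powr q * K) powr (1 / q)) * SR_norm p q f"
      using K by (simp add: epowr_mult SR_norm_eq)
  qed
qed

lemma SR_le_riesz:
  assumes p: "1 \<le> p" "p < q" and lam: "lam = real CARD('n) * (1 / p - 1 / q)"
  shows "\<exists>C>0. \<forall>f :: real^'n \<Rightarrow> real. locally_integrable f \<and> (AE x in lebesgue. f x \<ge> 0) \<longrightarrow>
    SR_norm p q f \<le> ennreal C * H_norm q lam f"
proof -
  have q: "0 < q" using p by simp
  have lamn: "lam \<le> real CARD('n)"
  proof -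
    have "1 / p \<le> 1" "0 < 1 / q" using p by auto
    then have "1 / p - 1 / q \<le> 1" by linarith
    then show ?thesis by (simp add: lam)
  qed
  define K where "K = 2 * (real CARD('n) powr (real CARD('n) - lam)) powr q"
  have K: "0 < K" by (simp add: K_def)
  have "SR_norm p q f \<le> ennreal (K powr (1 / q)) * H_norm q lam f"
    if f: "locally_integrable f" "AE x in lebesgue. f x \<ge> 0" for f :: "real^'n \<Rightarrow> real"
  proof -
    have "SR_sum p q f \<le> ennreal K * (\<integral>\<^sup>+x. epowr (riesz_abs lam f x) q \<partial>lebesgue)"
      unfolding K_def by (rule SR_sum_le_riesz[OF f(1) q lam lamn riesz_nn_le_abs[OF f(2)]])
    then have "SR_norm p q f \<le> epowr (ennreal K * (\<integral>\<^sup>+x. epowr (riesz_abs lam f x) q \<partial>lebesgue)) (1 / q)"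
      unfolding SR_norm_eq using q by (intro epowr_mono) auto
    then show ?thesis
      using K by (simp add: epowr_mult H_norm_def)
  qed
  moreover have "0 < K powr (1 / q)"
    using K by simp
  ultimately show ?thesis
    by blast
qed

lemma SR_H_equivalence:
  assumes p: "1 \<le> p" "p < q" and lam: "lam = real CARD('n) * (1 / p - 1 / q)"
  shows "(\<exists>C>0. \<forall>f :: real^'n \<Rightarrow> real. locally_integrable f \<and> (AE x in lebesgue. f x \<ge> 0) \<longrightarrow>
        SR_norm p q f \<le> ennreal C * H_norm q lam f \<and> H_norm q lam f \<le> ennreal C * SR_norm p q f)
    \<and> (\<exists>C>0. \<forall>f :: real^'n \<Rightarrow> real. locally_integrable f \<and> SR_norm p q f < \<infinity> \<longrightarrow>
        (AE x in lebesgue. integrable lebesgue (\<lambda>y. f y * norm (x - y) powr (lam - real CARD('n)))) \<and>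
        H_norm q lam f \<le> ennreal C * SR_norm p q f)"
proof -
  obtain C1 where C1: "C1 > 0" "\<And>f :: real^'n \<Rightarrow> real. locally_integrable f \<Longrightarrow>
      SR_norm p q f < \<infinity> \<Longrightarrow> (AE x in lebesgue. integrable lebesgue (\<lambda>y. f y * norm (x - y) powr (lam - real CARD('n))))"
      "\<And>f :: real^'n \<Rightarrow> real. locally_integrable f \<Longrightarrow> H_norm q lam f \<le> ennreal C1 * SR_norm p q f"
    using riesz_le_SR[OF p lam] by blast
  obtain C2 where C2: "C2 > 0" "\<And>f :: real^'n \<Rightarrow> real. locally_integrable f \<Longrightarrow> (AE x in lebesgue. f x \<ge> 0) \<Longrightarrow>
      SR_norm p q f \<le> ennreal C2 * H_norm q lam f"
    using SR_le_riesz[OF p lam] by blast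
  have mono: "a \<le> ennreal C1 * b \<Longrightarrow> a \<le> ennreal (max C1 C2) * b" "a \<le> ennreal C2 * b \<Longrightarrow> a \<le> ennreal (max C1 C2) * b"
    for a b
    by (erule order_trans, intro mult_right_mono ennreal_leI, auto)+
  show ?thesis
    using C1 C2 mono by (intro conjI exI[of _ "max C1 C2"]) (auto simp: less_max_iff_disj)
qed

theorem theorem1p6:
  fixes p q :: real
  assumes "1 \<le> p" and "p < q"
  shows
   "(\<exists>C>0. \<forall>f :: real^'n \<Rightarrow> real. locally_integrable f \<and> (AE x in lebesgue. f x \<ge> 0) \<longrightarrow>
        SR_norm p q f \<le> ennreal C * H_norm q (real CARD('n) * (1/p - 1/q)) f \<and>
        H_norm q (real CARD('n) * (1/p - 1/q)) f \<le> ennreal C * SR_norm p q f)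
    \<and> (\<exists>C>0. \<forall>f :: real^'n \<Rightarrow> real. locally_integrable f \<and> SR_norm p q f < \<infinity> \<longrightarrow>
        (AE x in lebesgue. integrable lebesgue
             (\<lambda>y. f y * norm (x - y) powr (real CARD('n) * (1/p - 1/q) - real CARD('n)))) \<and>
        H_norm q (real CARD('n) * (1/p - 1/q)) f \<le> ennreal C * SR_norm p q f)
    \<and> (CARD('n) \<ge> 2 \<longrightarrow>
        (\<exists>C>0. \<forall>f :: real^'n \<Rightarrow> real. locally_integrable f \<and> (AE x in lebesgue. f x \<ge> 0) \<longrightarrow>
           SR_norm (2 * real CARD('n) / (real CARD('n) + 2)) 2 f \<le> ennreal C * H_norm 2 1 f \<and>
           H_norm 2 1 f \<le> ennreal C * SR_norm (2 * real CARD('n) / (real CARD('n) + 2)) 2 f)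
      \<and> (\<exists>C>0. \<forall>f :: real^'n \<Rightarrow> real. locally_integrable f \<and>
             SR_norm (2 * real CARD('n) / (real CARD('n) + 2)) 2 f < \<infinity> \<longrightarrow>
           (AE x in lebesgue. integrable lebesgue
              (\<lambda>y. f y * norm (x - y) powr (1 - real CARD('n)))) \<and>
           H_norm 2 1 f \<le> ennreal C * SR_norm (2 * real CARD('n) / (real CARD('n) + 2)) 2 f))"
proof -
  have "2 * real CARD('n) / (real CARD('n) + 2) < 2"
    by (simp add: divide_less_eq)
  \<comment> \<open>For this exponent p \<ge> 1 says exactly n \<ge> 2.\<close>
  moreover have "1 \<le> 2 * real CARD('n) / (real CARD('n) + 2)" if "CARD('n) \<ge> 2"
    using that by (simp add: le_divide_eq)
  \<comment> \<open>Here 1/p - 1/2 = 1/n, so the order of the potential is 1.\<close>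
  moreover have "1 = real CARD('n) * (1 / (2 * real CARD('n) / (real CARD('n) + 2)) - 1 / 2)"
    by (simp add: field_simps)
  ultimately have "CARD('n) \<ge> 2 \<Longrightarrow> ?thesis"
    using SR_H_equivalence[OF assms refl, where 'n='n]
      SR_H_equivalence[of "2 * real CARD('n) / (real CARD('n) + 2)" 2 1, where 'n='n]
    by simp
  then show ?thesis
    using SR_H_equivalence[OF assms refl, where 'n='n] by blast
qed

end
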